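(* There is no partial computable function $f$ such that, whenever $e$ is an index for a computable $2$-coloring $c:[\mathbb{N}]^2\to\{\text{BLUE},\text{RED}\}$, $f(e)$ is (defined and is) an index for a finite c.e. set $W_{f(e)}$ one of whose elements is an index for a $\Delta^0_2$ path decomposition for $c$.
   Context: A (monochromatic) path of color $k$ is a finite or infinite list of distinct natural numbers in which every two consecutive elements form a pair of color $k$ (empty and one-element lists are paths of every color). An index for a computable coloring $c$ is a number $e$ such that $\varphi_e$ computes $c$. $W_i$ denotes the $i$-th computably enumerable set. A $\Delta^0_2$ path decomposition for $c$ is a pair $(P_b,P_r)$ of partial $\emptyset'$-computable functions whose domains are initial segments of $\mathbb{N}$, whose ranges partition $\mathbb{N}$, such that $c(\{P_b(n),P_b(n+1)\})$ is BLUE whenever $n+1\in\mathrm{dom}(P_b)$ and $c(\{P_r(n),P_r(n+1)\})$ is RED whenever $n+1\in\mathrm{dom}(P_r)$. An index for such a decomposition is (a code for) a pair $(i_b,i_r)$ with $\Phi_{i_b}^{\emptyset'}=P_b$ and $\Phi_{i_r}^{\emptyset'}=P_r$. *)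

theory Defs
  imports Main "HOL-Library.Nat_Bijection"
begin

section \<open>Oracle computable partial functions\<close>

text \<open>
  Kleene's schemes for the partial functions computable relative to a set, in unary form:
  a function of several arguments acts on tuples coded by the Cantor pairing function.
  All other projections arise from \<open>Fst\<close> and \<open>Snd\<close> by composition, and the identity is
  \<open>Pair Fst Snd\<close>, since the pairing function is a bijection.
\<close>

datatype recf =
    Zero
  | Succ
  | Fst
  | Snd
  | Oracle
  | Pair recf recf
  | Comp recf recf
  | Prec recf recf
  | Mu recf

text \<open>
  In the clause for \<open>Mu\<close> the search diverges if it meets an undefined value before the first
  zero.  If the condition holds then the least zero is preceded by defined values only.
\<close>

primrec eval :: "nat set \<Rightarrow> recf \<Rightarrow> nat \<rightharpoonup> nat" where
  "eval A Zero = (\<lambda>x. Some 0)"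
| "eval A Succ = (\<lambda>x. Some (Suc x))"
| "eval A Fst = (\<lambda>x. Some (fst (prod_decode x)))"
| "eval A Snd = (\<lambda>x. Some (snd (prod_decode x)))"
| "eval A Oracle = (\<lambda>x. Some (if x \<in> A then 1 else 0))"
| "eval A (Pair p q) = (\<lambda>x. Option.bind (eval A p x) (\<lambda>y.
     Option.bind (eval A q x) (\<lambda>z. Some (prod_encode (y, z)))))"
| "eval A (Comp p q) = (\<lambda>x. Option.bind (eval A q x) (eval A p))"
| "eval A (Prec p q) = (\<lambda>x. case prod_decode x of (a, n) \<Rightarrow>
     rec_nat (eval A p a)
       (\<lambda>m r. Option.bind r (\<lambda>y. eval A q (prod_encode (a, prod_encode (m, y))))) n)"
| "eval A (Mu p) = (\<lambda>a.
     if \<exists>n. eval A p (prod_encode (a, n)) = Some 0 \<and>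
            (\<forall>m<n. eval A p (prod_encode (a, m)) \<noteq> None)
     then Some (LEAST n. eval A p (prod_encode (a, n)) = Some 0)
     else None)"

primrec goedel :: "recf \<Rightarrow> nat" where
  "goedel Zero = 0"
| "goedel Succ = 1"
| "goedel Fst = 2"
| "goedel Snd = 3"
| "goedel Oracle = 4"
| "goedel (Pair p q) = 5 + 4 * prod_encode (goedel p, goedel q)"
| "goedel (Comp p q) = 6 + 4 * prod_encode (goedel p, goedel q)"
| "goedel (Prec p q) = 7 + 4 * prod_encode (goedel p, goedel q)"
| "goedel (Mu p) = 8 + 4 * goedel p"

lemma inj_goedel: "inj goedel"
proof (rule injI)
  fix p q
  show "goedel p = goedel q \<Longrightarrow> p = q"
  proof (induction p arbitrary: q)
    case Zero then show ?case by (cases q) auto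
  next
    case Succ then show ?case by (cases q) auto
  next
    case Fst then show ?case by (cases q) auto
  next
    case Snd then show ?case by (cases q) auto
  next
    case Oracle then show ?case by (cases q) auto
  next
    case (Pair p1 p2) then show ?case by (cases q) (auto, presburger+)
  next
    case (Comp p1 p2) then show ?case by (cases q) (auto, presburger+)
  next
    case (Prec p1 p2) then show ?case by (cases q) (auto, presburger+)
  next
    case (Mu p) then show ?case by (cases q) (auto, presburger+)
  qed
qed

lemma surj_goedel: "surj goedel"
proof -
  have "\<exists>p. goedel p = n" for n
  proof (induction n rule: less_induct)
    case (less n)
    show ?case
    proof (cases "n < 5")
      case True
      then have "n = 0 \<or> n = 1 \<or> n = 2 \<or> n = 3 \<or> n = 4" by auto
      then show ?thesis by (metis goedel.simps(1-5))
    next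
      case False
      define k where "k = (n - 5) div 4"
      obtain a b where ab: "prod_encode (a, b) = k"
        by (metis prod_decode_inverse surj_pair)
      have "k < n" using False by (auto simp: k_def)
      moreover have "a \<le> k" "b \<le> k"
        using ab le_prod_encode_1[of a b] le_prod_encode_2[of b a] by auto
      ultimately obtain p q r where pqr: "goedel p = a" "goedel q = b" "goedel r = k"
        using less.IH by (meson le_less_trans)
      have "n = 5 + 4 * k \<or> n = 6 + 4 * k \<or> n = 7 + 4 * k \<or> n = 8 + 4 * k"
        using False unfolding k_def by presburger
      then show ?thesis using pqr ab by (metis goedel.simps(6-9))
    qed
  qed
  then show ?thesis by (metis surjI)
qed

lemma bij_goedel: "bij goedel"
  by (simp add: bij_def inj_goedel surj_goedel)

definition Phi :: "nat set \<Rightarrow> nat \<Rightarrow> nat \<rightharpoonup> nat" where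
  "Phi A e = eval A (inv goedel e)"

abbreviation phi :: "nat \<Rightarrow> nat \<rightharpoonup> nat" where
  "phi \<equiv> Phi {}"

definition partial_computable_in :: "nat set \<Rightarrow> (nat \<rightharpoonup> nat) \<Rightarrow> bool" where
  "partial_computable_in A f \<longleftrightarrow> (\<exists>e. Phi A e = f)"

abbreviation partial_computable :: "(nat \<rightharpoonup> nat) \<Rightarrow> bool" where
  "partial_computable \<equiv> partial_computable_in {}"

definition W :: "nat \<Rightarrow> nat set" where
  "W i = dom (phi i)"

definition halting_set :: "nat set" where
  "halting_set = {e. e \<in> W e}"


section \<open>Colorings and path decompositions\<close>

datatype color = BLUE | RED

primrec color_code :: "color \<Rightarrow> nat" where
  "color_code BLUE = 0"
| "color_code RED = 1"

text \<open>
  A coloring of \<open>[\<nat>]\<^sup>2\<close> is a function on sets of which only the values on two-element sets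
  matter.  A two-element set is presented to a computation as its increasing pair.
\<close>

definition coloring_index :: "nat \<Rightarrow> (nat set \<Rightarrow> color) \<Rightarrow> bool" where
  "coloring_index e c \<longleftrightarrow>
     (\<forall>x y. x < y \<longrightarrow> phi e (prod_encode (x, y)) = Some (color_code (c {x, y})))"

text \<open>
  A finite or infinite list is a partial function whose domain is an initial segment of the
  natural numbers; the entries of a path are distinct.
\<close>

definition mono_path :: "(nat set \<Rightarrow> color) \<Rightarrow> color \<Rightarrow> (nat \<rightharpoonup> nat) \<Rightarrow> bool" where
  "mono_path c k P \<longleftrightarrow>
     (\<forall>n\<in>dom P. \<forall>m<n. m \<in> dom P) \<and>
     inj_on P (dom P) \<and>
     (\<forall>n x y. P n = Some x \<longrightarrow> P (Suc n) = Some y \<longrightarrow> c {x, y} = k)"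

definition delta2_path_decomposition ::
  "(nat set \<Rightarrow> color) \<Rightarrow> (nat \<rightharpoonup> nat) \<Rightarrow> (nat \<rightharpoonup> nat) \<Rightarrow> bool" where
  "delta2_path_decomposition c Pb Pr \<longleftrightarrow>
     partial_computable_in halting_set Pb \<and> partial_computable_in halting_set Pr \<and>
     mono_path c BLUE Pb \<and> mono_path c RED Pr \<and>
     ran Pb \<union> ran Pr = UNIV \<and> ran Pb \<inter> ran Pr = {}"

definition decomposition_index ::
  "nat \<Rightarrow> (nat \<rightharpoonup> nat) \<Rightarrow> (nat \<rightharpoonup> nat) \<Rightarrow> bool" where
  "decomposition_index d Pb Pr \<longleftrightarrow>
     (\<exists>ib ir. d = prod_encode (ib, ir) \<and> Phi halting_set ib = Pb \<and> Phi halting_set ir = Pr)"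

end

theory Submission
  imports Defs
begin

text \<open>
  By the recursion theorem a coloring may refer to its own index \<open>e\<close>, hence to the finite set
  \<open>D = W (f e)\<close> of candidates as it is enumerated.  Suppose that from some point on all vertices
  below \<open>u\<close> are joined to new vertices in blue, and the vertices of a block of \<open>u + 2\<close> further
  vertices in red.  The blue path cannot contain the block, so the red path of a correct
  decomposition leaves the vertices below \<open>u\<close>, or starts outside of them.  One keeps this up
  against one candidate until the approximation to its red path does so, and then attacks another
  candidate or exchanges the colors.  While one attack lasts, the remaining candidates are attacked
  in the same way on the vertices beyond the block; now the red path may also leave through one of
  the finitely many vertices \<open>< b\<close> whose colors are fixed by the earlier attacks.

  A correct candidate answers every attack, so it is not the target of an attack that lasts forever.
  As there are finitely many candidates, some level of this nesting is renewed infinitely often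
  while the levels before it are constant.  There the correct candidate is attacked, and answers,
  infinitely often in both colors, with \<open>b\<close> fixed and \<open>u\<close> unbounded.  But if, say, its red path is
  infinite, then the vertices below \<open>b\<close> and their red successors stabilize, so that it can answer
  only for finitely many \<open>u\<close>.
\<close>

section \<open>Computable total functions on encoded types\<close>

class encodable =
  fixes encode :: "'a \<Rightarrow> nat"

instantiation nat :: encodable
begin
definition encode_nat_def [simp]: "encode n = (n::nat)"
instance ..
end

instantiation bool :: encodable
begin
definition encode_bool_def: "encode b = (if b then 1 else (0::nat))"
instance ..
end

instantiation prod :: (encodable, encodable) encodable
begin
definition encode_prod_def: "encode p = prod_encode (encode (fst p), encode (snd p))"
instance ..
end

instantiation option :: (encodable) encodable
begin
definition encode_option_def: "encode z = (case z of None \<Rightarrow> 0 | Some y \<Rightarrow> Suc (encode y))"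
instance ..
end

instantiation list :: (encodable) encodable
begin
primrec encode_list :: "'a list \<Rightarrow> nat" where
  "encode_list [] = 0"
| "encode_list (y # ys) = Suc (prod_encode (encode y, encode_list ys))"
instance ..
end

instantiation recf :: encodable
begin
definition encode_recf_def: "encode p = goedel p"
instance ..
end

lemma encode_Pair [simp]: "encode (x, y) = prod_encode (encode x, encode y)"
  by (simp add: encode_prod_def)

lemma encode_option_simps [simp]: "encode None = 0" "encode (Some y) = Suc (encode y)"
  by (simp_all add: encode_option_def)

lemma length_le_encode: "length xs \<le> encode xs"
proof (induction xs)
  case (Cons x xs)
  then show ?case using le_prod_encode_2[of "encode xs" "encode x"] by simp
qed simp

text \<open>One program has to serve every oracle, so that the closure rules need not mention
  oracles. On numbers that encode nothing it may return anything or diverge.\<close>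

definition computable :: "('a::encodable \<Rightarrow> 'b::encodable) \<Rightarrow> bool" where
  "computable f \<longleftrightarrow> (\<exists>p. \<forall>A x. eval A p (encode x) = Some (encode (f x)))"

section \<open>Closure under composition, primitive recursion and case distinction\<close>

named_theorems computable_intros

lemma computableI: "(\<And>A x. eval A p (encode x) = Some (encode (f x))) \<Longrightarrow> computable f"
  unfolding computable_def by blast

lemma computableE:
  assumes "computable f"
  obtains p where "\<And>A x. eval A p (encode x) = Some (encode (f x))"
  using assms unfolding computable_def by blast

text \<open>The values of f and g may have different types: passing between a program and its Goedel
  number, or a pair and its code, changes the type but not the encoded number.\<close>

lemma computable_cong_encode:
  assumes "computable f" "\<And>x. encode (g x) = encode (f x)"
  shows "computable g"
  using assms unfolding computable_def by simp

lemma computable_id [computable_intros]: "computable (\<lambda>x. x)"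
  by (rule computableI[where p = "Pair Fst Snd"]) simp

lemma computable_compose:
  assumes "computable f" "computable g"
  shows "computable (\<lambda>x. f (g x))"
proof -
  obtain p q where "\<And>A x. eval A p (encode x) = Some (encode (f x))"
    "\<And>A x. eval A q (encode x) = Some (encode (g x))"
    using assms by (meson computableE)
  then show ?thesis by (intro computableI[where p = "Comp p q"]) simp
qed

lemma computable_Pair [computable_intros]:
  assumes "computable f" "computable g"
  shows "computable (\<lambda>x. (f x, g x))"
proof -
  obtain p q where "\<And>A x. eval A p (encode x) = Some (encode (f x))"
    "\<And>A x. eval A q (encode x) = Some (encode (g x))"
    using assms by (meson computableE)
  then show ?thesis by (intro computableI[where p = "Pair p q"]) simp
qed

lemma computable_fst [computable_intros]: "computable f \<Longrightarrow> computable (\<lambda>x. fst (f x))"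
  by (rule computable_compose[of fst]) (rule computableI[where p = Fst], simp add: encode_prod_def)

lemma computable_snd [computable_intros]: "computable f \<Longrightarrow> computable (\<lambda>x. snd (f x))"
  by (rule computable_compose[of snd]) (rule computableI[where p = Snd], simp add: encode_prod_def)

lemma computable_Suc [computable_intros]: "computable f \<Longrightarrow> computable (\<lambda>x. Suc (f x))"
  by (rule computable_compose[of Suc]) (rule computableI[where p = Succ], simp)

primrec const_recf :: "nat \<Rightarrow> recf" where
  "const_recf 0 = Zero"
| "const_recf (Suc n) = Comp Succ (const_recf n)"

lemma eval_const_recf [simp]: "eval A (const_recf n) x = Some n"
  by (induction n) simp_all

lemma computable_const [computable_intros]: "computable (\<lambda>x. c)"
  by (rule computableI[where p = "const_recf (encode c)"]) simp

lemma computable_case_prod [computable_intros]: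
  assumes "computable (\<lambda>x. h x (fst (f x)) (snd (f x)))"
  shows "computable (\<lambda>x. case f x of (a, b) \<Rightarrow> h x a b)"
  using assms by (simp add: split_beta)

lemma computable_rec_nat [computable_intros]:
  fixes a :: "'a::encodable \<Rightarrow> 'b::encodable"
  assumes "computable a" "computable (\<lambda>z. h (fst z) (fst (snd z)) (snd (snd z)))" "computable n"
  shows "computable (\<lambda>x. rec_nat (a x) (h x) (n x))"
proof -
  obtain p q r where p: "\<And>A x. eval A p (encode x) = Some (encode (a x))"
    and q: "\<And>A z. eval A q (encode z) = Some (encode (h (fst z) (fst (snd z)) (snd (snd z))))"
    and r: "\<And>A x. eval A r (encode x) = Some (encode (n x))"
    using assms by (meson computableE)
  have "rec_nat (eval A p (encode x)) (\<lambda>m r. Option.bind r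
     (\<lambda>y. eval A q (prod_encode (encode x, prod_encode (m, y))))) k = Some (encode (rec_nat (a x) (h x) k))" for A x k
  proof (induction k)
    case (Suc k)
    then show ?case using q[of A "(x, k, rec_nat (a x) (h x) k)"] by simp
  qed (simp add: p)
  then show ?thesis
    by (intro computableI[where p = "Comp (Prec p q) (Pair (Pair Fst Snd) r)"]) (simp add: r)
qed

text \<open>
  Only the branch that is taken is evaluated, since the program for the other one may diverge on
  inputs that encode nothing.
\<close>

lemma eval_case_nat:
  fixes r f g :: recf
  shows
  "\<exists>q. \<forall>A x. eval A q x = (case eval A r x of None \<Rightarrow> None | Some 0 \<Rightarrow> eval A f x
     | Some (Suc m) \<Rightarrow> eval A g (prod_encode (x, m)))"
proof -
  define pre where "pre = Comp (Prec Zero (Comp Fst Snd)) (Pair Zero (Pair Fst Snd))"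
  define sg where "sg = Comp (Prec Zero (Comp (const_recf 1) Snd)) (Pair Zero (Pair Fst Snd))"
  have pre: "eval A pre n = Some (n - 1)" for A n
    by (cases n) (simp_all add: pre_def, induct_tac nat, simp_all)
  have sg: "eval A sg n = Some (if n = 0 then 0 else 1)" for A n
    by (cases n) (simp_all add: sg_def, induct_tac nat, simp_all)
  define nsg where "nsg = Comp (Prec (const_recf 1) Zero) (Pair Zero (Pair Fst Snd))"
  have nsg: "eval A nsg n = Some (if n = 0 then 1 else 0)" for A n
    by (cases n) (simp_all add: nsg_def, induct_tac nat, simp_all)
  \<comment> \<open>Each branch is the step of a primitive recursion of length 0 or 1, the length
    being \<open>nsg\<close> or \<open>sg\<close> of the value of r. A recursion of length 0 never
    evaluates its step.\<close>
  define q where "q = Comp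
    (Prec (Comp (Prec Zero (Comp f (Comp Fst Fst))) (Pair (Pair Fst Snd) (Comp nsg Snd)))
       (Comp g (Pair (Comp Fst Fst) (Comp pre (Comp Snd Fst)))))
    (Pair (Pair (Pair Fst Snd) r) (Comp sg r))"
  have "eval A q x = (case eval A r x of None \<Rightarrow> None | Some 0 \<Rightarrow> eval A f x
     | Some (Suc m) \<Rightarrow> eval A g (prod_encode (x, m)))" for A x
    by (cases "eval A r x") (auto simp: q_def pre sg nsg split: nat.split)
  then show ?thesis by blast
qed

lemma computable_If [computable_intros]:
  assumes "computable b" "computable f" "computable g"
  shows "computable (\<lambda>x. if b x then f x else g x)"
proof -
  obtain r p1 p2 where r: "\<And>A x. eval A r (encode x) = Some (encode (b x))"
    and p: "\<And>A x. eval A p1 (encode x) = Some (encode (g x))"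
      "\<And>A x. eval A p2 (encode x) = Some (encode (f x))"
    using assms by (meson computableE)
  obtain q where "\<And>A x. eval A q x = (case eval A r x of None \<Rightarrow> None | Some 0 \<Rightarrow> eval A p1 x
     | Some (Suc m) \<Rightarrow> eval A (Comp p2 Fst) (prod_encode (x, m)))"
    using eval_case_nat[where r = r and f = p1 and g = "Comp p2 Fst"] by blast
  with r p show ?thesis by (intro computableI[where p = q]) (simp add: encode_bool_def)
qed

lemma computable_case_option [computable_intros]:
  assumes "computable z" "computable f" "computable (\<lambda>u. h (fst u) (snd u))"
  shows "computable (\<lambda>x. case z x of None \<Rightarrow> f x | Some y \<Rightarrow> h x y)"
proof -
  obtain r p1 p2 where r: "\<And>A x. eval A r (encode x) = Some (encode (z x))"
    and p1: "\<And>A x. eval A p1 (encode x) = Some (encode (f x))"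
    and p2: "\<And>A u. eval A p2 (encode u) = Some (encode (h (fst u) (snd u)))"
    using assms by (meson computableE)
  obtain q where q: "\<And>A x. eval A q x = (case eval A r x of None \<Rightarrow> None | Some 0 \<Rightarrow> eval A p1 x
     | Some (Suc m) \<Rightarrow> eval A p2 (prod_encode (x, m)))"
    using eval_case_nat[where r = r and f = p1 and g = p2] by blast
  have "eval A q (encode x) = Some (encode (case z x of None \<Rightarrow> f x | Some y \<Rightarrow> h x y))" for A x
    using p2[of A "(x, the (z x))"] by (cases "z x") (simp_all add: q r p1)
  then show ?thesis by (rule computableI)
qed

lemma computable_case_list [computable_intros]:
  assumes "computable l" "computable f" "computable (\<lambda>u. h (fst u) (fst (snd u)) (snd (snd u)))"
  shows "computable (\<lambda>x. case l x of [] \<Rightarrow> f x | y # ys \<Rightarrow> h x y ys)"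
proof -
  obtain r p1 p2 where r: "\<And>A x. eval A r (encode x) = Some (encode (l x))"
    and p1: "\<And>A x. eval A p1 (encode x) = Some (encode (f x))"
    and p2: "\<And>A u. eval A p2 (encode u) = Some (encode (h (fst u) (fst (snd u)) (snd (snd u))))"
    using assms by (meson computableE)
  obtain q where q: "\<And>A x. eval A q x = (case eval A r x of None \<Rightarrow> None | Some 0 \<Rightarrow> eval A p1 x
     | Some (Suc m) \<Rightarrow> eval A p2 (prod_encode (x, m)))"
    using eval_case_nat[where r = r and f = p1 and g = p2] by blast
  have "eval A q (encode x) = Some (encode (case l x of [] \<Rightarrow> f x | y # ys \<Rightarrow> h x y ys))" for A x
    using p2[of A "(x, hd (l x), tl (l x))"] by (cases "l x") (simp_all add: q r p1)
  then show ?thesis by (rule computableI)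
qed

lemma computable_case_nat [computable_intros]:
  assumes "computable n" "computable f" "computable (\<lambda>u. h (fst u) (snd u))"
  shows "computable (\<lambda>x. case n x of 0 \<Rightarrow> f x | Suc m \<Rightarrow> h x m)"
proof -
  have "computable (\<lambda>x. rec_nat (f x) (\<lambda>m r. h x m) (n x))"
    by (intro computable_intros assms computable_compose[OF assms(3), of "\<lambda>z. (fst z, fst (snd z))", simplified])
  moreover have "rec_nat (f x) (\<lambda>m r. h x m) (n x) = (case n x of 0 \<Rightarrow> f x | Suc m \<Rightarrow> h x m)" for x
    by (cases "n x") simp_all
  ultimately show ?thesis by simp
qed

section \<open>Connectives, arithmetic and bounded quantifiers\<close>

lemma computable_not [computable_intros]:
  assumes "computable b"
  shows "computable (\<lambda>x. \<not> b x)"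
proof -
  have "computable (\<lambda>x. if b x then False else True)"
    by (intro computable_intros assms)
  then show ?thesis by (rule computable_cong_encode) simp
qed

lemma computable_conj [computable_intros]:
  assumes "computable b" "computable c"
  shows "computable (\<lambda>x. b x \<and> c x)"
proof -
  have "computable (\<lambda>x. if b x then c x else False)"
    by (intro computable_intros assms)
  then show ?thesis by (rule computable_cong_encode) simp
qed

lemma computable_disj [computable_intros]:
  assumes "computable b" "computable c"
  shows "computable (\<lambda>x. b x \<or> c x)"
proof -
  have "computable (\<lambda>x. if b x then True else c x)"
    by (intro computable_intros assms)
  then show ?thesis by (rule computable_cong_encode) simp
qed

lemma computable_add [computable_intros]:
  fixes f g :: "'a::encodable \<Rightarrow> nat"
  assumes "computable f" "computable g"
  shows "computable (\<lambda>x. f x + g x)"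
proof -
  have "computable (\<lambda>x. rec_nat (f x) (\<lambda>m r. Suc r) (g x))"
    by (intro computable_intros assms)
  moreover have "rec_nat m (\<lambda>m r. Suc r) n = m + n" for m n
    by (induction n) simp_all
  ultimately show ?thesis by simp
qed

lemma computable_diff [computable_intros]:
  fixes f g :: "'a::encodable \<Rightarrow> nat"
  assumes "computable f" "computable g"
  shows "computable (\<lambda>x. f x - g x)"
proof -
  have "computable (\<lambda>x. rec_nat (f x) (\<lambda>m r. case r of 0 \<Rightarrow> 0 | Suc k \<Rightarrow> k) (g x))"
    by (intro computable_intros assms)
  moreover have "rec_nat m (\<lambda>m r. case r of 0 \<Rightarrow> 0 | Suc k \<Rightarrow> k) n = m - n" for m n :: nat
    by (induction n) (simp_all add: diff_Suc)
  ultimately show ?thesis by simp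
qed

lemma computable_mult [computable_intros]:
  fixes f g :: "'a::encodable \<Rightarrow> nat"
  assumes "computable f" "computable g"
  shows "computable (\<lambda>x. f x * g x)"
proof -
  have "computable (\<lambda>x. rec_nat 0 (\<lambda>m r. r + f x) (g x))"
    by (intro computable_intros assms computable_compose[OF assms(1)])
  moreover have "rec_nat 0 (\<lambda>m r. r + a) n = a * n" for a n :: nat
    by (induction n) simp_all
  ultimately show ?thesis by simp
qed

lemma computable_eq_0:
  fixes f :: "'a::encodable \<Rightarrow> nat"
  assumes "computable f"
  shows "computable (\<lambda>x. f x = 0)"
proof -
  have "computable (\<lambda>x. case f x of 0 \<Rightarrow> True | Suc m \<Rightarrow> False)"
    by (intro computable_intros assms)
  moreover have "(case n of 0 \<Rightarrow> True | Suc m \<Rightarrow> False) \<longleftrightarrow> n = 0" for n :: nat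
    by (cases n) simp_all
  ultimately show ?thesis by simp
qed

lemma computable_le [computable_intros]:
  fixes f g :: "'a::encodable \<Rightarrow> nat"
  assumes "computable f" "computable g"
  shows "computable (\<lambda>x. f x \<le> g x)"
  using computable_eq_0[OF computable_diff[OF assms]] by simp

lemma computable_less [computable_intros]:
  fixes f g :: "'a::encodable \<Rightarrow> nat"
  assumes "computable f" "computable g"
  shows "computable (\<lambda>x. f x < g x)"
  using computable_not[OF computable_le[OF assms(2,1)]] by (simp add: not_le)

lemma computable_eq [computable_intros]:
  fixes f g :: "'a::encodable \<Rightarrow> nat"
  assumes "computable f" "computable g"
  shows "computable (\<lambda>x. f x = g x)"
  using computable_conj[OF computable_le[OF assms] computable_le[OF assms(2,1)]] by (simp add: order_eq_iff)

lemma computable_max [computable_intros]: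
  fixes f g :: "'a::encodable \<Rightarrow> nat"
  assumes "computable f" "computable g"
  shows "computable (\<lambda>x. max (f x) (g x))"
  unfolding max_def by (intro computable_intros assms)

text \<open>The divisor 4 is singled out because \<open>goedel\<close> distinguishes the four
  compound constructors by residues modulo 4.\<close>

lemma computable_mod_4 [computable_intros]:
  fixes f :: "'a::encodable \<Rightarrow> nat"
  assumes "computable f"
  shows "computable (\<lambda>x. f x mod 4)"
proof -
  have "computable (\<lambda>x. rec_nat 0 (\<lambda>m r. if r = 3 then 0 else Suc r) (f x))"
    by (intro computable_intros assms)
  moreover have "rec_nat 0 (\<lambda>m r. if r = 3 then 0 else Suc r) n = n mod 4" for n :: nat
    by (induction n) (simp_all add: mod_Suc)
  ultimately show ?thesis by simp
qed

lemma computable_div_4 [computable_intros]: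
  fixes f :: "'a::encodable \<Rightarrow> nat"
  assumes "computable f"
  shows "computable (\<lambda>x. f x div 4)"
proof -
  have "computable (\<lambda>x. rec_nat 0 (\<lambda>m r. if m mod 4 = 3 then Suc r else r) (f x))"
    by (intro computable_intros assms)
  moreover have "rec_nat 0 (\<lambda>m r. if m mod 4 = 3 then Suc r else r) n = n div 4" for n :: nat
    by (induction n) (simp_all add: div_Suc mod_Suc)
  ultimately show ?thesis by simp
qed

lemma computable_even [computable_intros]:
  fixes f :: "'a::encodable \<Rightarrow> nat"
  assumes "computable f"
  shows "computable (\<lambda>x. even (f x))"
proof -
  have "computable (\<lambda>x. rec_nat True (\<lambda>m r. \<not> r) (f x))"
    by (intro computable_intros assms)
  moreover have "rec_nat True (\<lambda>m r. \<not> r) n = even n" for n :: nat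
    by (induction n) simp_all
  ultimately show ?thesis by simp
qed

lemma computable_ex_le [computable_intros]:
  fixes b :: "'a::encodable \<Rightarrow> nat \<Rightarrow> bool"
  assumes "computable (\<lambda>u. b (fst u) (snd u))" "computable n"
  shows "computable (\<lambda>x. \<exists>t\<le>n x. b x t)"
proof -
  have b: "computable f \<Longrightarrow> computable g \<Longrightarrow> computable (\<lambda>x. b (f x) (g x))" for f :: "'c::encodable \<Rightarrow> _" and g
    using computable_compose[OF assms(1), of "\<lambda>x. (f x, g x)"] by (simp add: computable_Pair)
  have "computable (\<lambda>x. rec_nat False (\<lambda>m r. r \<or> b x m) (Suc (n x)))"
    by (intro computable_intros assms b)
  moreover have "rec_nat False (\<lambda>m r. r \<or> b x m) k \<longleftrightarrow> (\<exists>t<k. b x t)" for x k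
    by (induction k) (auto simp: less_Suc_eq)
  ultimately show ?thesis by (simp only: less_Suc_eq_le)
qed

lemma computable_all_less [computable_intros]:
  fixes b :: "'a::encodable \<Rightarrow> nat \<Rightarrow> bool"
  assumes "computable (\<lambda>u. b (fst u) (snd u))" "computable n"
  shows "computable (\<lambda>x. \<forall>t<n x. b x t)"
proof -
  have b: "computable f \<Longrightarrow> computable g \<Longrightarrow> computable (\<lambda>x. b (f x) (g x))" for f :: "'c::encodable \<Rightarrow> _" and g
    using computable_compose[OF assms(1), of "\<lambda>x. (f x, g x)"] by (simp add: computable_Pair)
  have "computable (\<lambda>x. rec_nat True (\<lambda>m r. r \<and> b x m) (n x))"
    by (intro computable_intros assms b)
  moreover have "rec_nat True (\<lambda>m r. r \<and> b x m) k \<longleftrightarrow> (\<forall>t<k. b x t)" for x k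
    by (induction k) (auto simp: less_Suc_eq)
  ultimately show ?thesis by simp
qed

lemma computable_Some [computable_intros]: "computable f \<Longrightarrow> computable (\<lambda>x. Some (f x))"
  by (rule computable_compose[of Some]) (rule computableI[where p = Succ], simp)

section \<open>List functions\<close>

lemma computable_Cons [computable_intros]:
  assumes "computable f" "computable l"
  shows "computable (\<lambda>x. f x # l x)"
proof (rule computable_cong_encode)
  have "computable (encode :: 'b \<times> 'b list \<Rightarrow> nat)"
    by (rule computableI[of "Pair Fst Snd"]) simp
  then show "computable (\<lambda>x. Suc (encode (f x, l x)))"
    by (rule computable_Suc[OF computable_compose[OF _ computable_Pair[OF assms]]])
qed simp

lemma computable_foldl [computable_intros]:
  fixes a :: "'a::encodable \<Rightarrow> 'b::encodable" and l :: "'a \<Rightarrow> 'c::encodable list"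
  assumes g: "computable (\<lambda>u. g (fst u) (fst (snd u)) (snd (snd u)))"
    and a: "computable a" and l: "computable l"
  shows "computable (\<lambda>x. foldl (g x) (a x) (l x))"
proof -
  define step where "step x z = (case snd z of [] \<Rightarrow> z | y # ys \<Rightarrow> (g x (fst z) y, ys))"
    for x and z :: "'b \<times> 'c list"
  have g': "computable (\<lambda>x. g (u x) (v x) (w x))"
    if "computable u" "computable v" "computable w" for u v w and x :: "'d::encodable"
    using computable_compose[OF g, of "\<lambda>x. (u x, v x, w x)"] that by (simp add: computable_Pair)
  \<comment> \<open>The code of a list bounds its length and so serves as the number of rounds;
    rounds after the list is used up change nothing.\<close>
  have "computable (\<lambda>x. fst (rec_nat (a x, l x) (\<lambda>m r. step x r) (encode (l x))))"
    unfolding step_def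
    by (intro computable_intros a l g' computable_compose[of encode, OF _ l]
        computableI[of "Pair Fst Snd" encode]) simp
  moreover have "fst (rec_nat (c, ys) (\<lambda>m r. step x r) n) = foldl (g x) c ys"
    if "length ys \<le> n" for n c ys x
  proof -
    have shift: "rec_nat z (\<lambda>m r. step x r) (Suc n) = rec_nat (step x z) (\<lambda>m r. step x r) n" for n z
      by (induction n) (simp_all only: nat.rec)
    show ?thesis using that
    proof (induction n arbitrary: c ys)
      case (Suc n)
      show ?case
        unfolding shift using Suc by (cases ys) (auto simp: step_def[of x "(_, _)"])
    qed simp
  qed
  ultimately show ?thesis by (simp add: length_le_encode)
qed

lemma computable_rev [computable_intros]:
  assumes "computable l"
  shows "computable (\<lambda>x. rev (l x))"
proof -
  have "computable (\<lambda>x. foldl (\<lambda>ys y. y # ys) [] (l x))"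
    by (intro computable_intros assms)
  moreover have "foldl (\<lambda>ys y. y # ys) zs xs = rev xs @ zs" for xs zs :: "'b list"
    by (induction xs arbitrary: zs) simp_all
  ultimately show ?thesis by simp
qed

lemma computable_append [computable_intros]:
  assumes "computable l" "computable k"
  shows "computable (\<lambda>x. l x @ k x)"
proof -
  have "computable (\<lambda>x. foldl (\<lambda>ys y. y # ys) (k x) (rev (l x)))"
    by (intro computable_intros assms)
  then show ?thesis by (simp add: foldl_conv_fold fold_Cons_rev)
qed

lemma computable_Bex_set [computable_intros]:
  assumes "computable (\<lambda>u. b (fst u) (snd u))" "computable l"
  shows "computable (\<lambda>x. \<exists>y\<in>set (l x). b x y)"
proof -
  have b: "computable f \<Longrightarrow> computable g \<Longrightarrow> computable (\<lambda>x. b (f x) (g x))" for f :: "'d::encodable \<Rightarrow> _" and g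
    using computable_compose[OF assms(1), of "\<lambda>x. (f x, g x)"] by (simp add: computable_Pair)
  have "computable (\<lambda>x. foldl (\<lambda>a y. a \<or> b x y) False (l x))"
    by (intro computable_intros assms b)
  moreover have "foldl (\<lambda>a y. a \<or> b x y) c ys \<longleftrightarrow> c \<or> (\<exists>y\<in>set ys. b x y)" for x ys c
    by (induction ys arbitrary: c) auto
  ultimately show ?thesis by simp
qed

lemma computable_find [computable_intros]:
  assumes "computable (\<lambda>u. b (fst u) (snd u))" "computable l"
  shows "computable (\<lambda>x. find (b x) (l x))"
proof -
  have b: "computable f \<Longrightarrow> computable g \<Longrightarrow> computable (\<lambda>x. b (f x) (g x))" for f :: "'d::encodable \<Rightarrow> _" and g
    using computable_compose[OF assms(1), of "\<lambda>x. (f x, g x)"] by (simp add: computable_Pair)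
  have "computable (\<lambda>x. foldl (\<lambda>a y. case a of None \<Rightarrow> if b x y then Some y else None | Some z \<Rightarrow> a) None (l x))"
    by (intro computable_intros assms b)
  moreover have "foldl (\<lambda>a y. case a of None \<Rightarrow> if b x y then Some y else None | Some z \<Rightarrow> a) (Some c) ys = Some c" for x ys c
    by (induction ys) auto
  then have "foldl (\<lambda>a y. case a of None \<Rightarrow> if b x y then Some y else None | Some z \<Rightarrow> a) None ys = find (b x) ys" for x ys
    by (induction ys) auto
  ultimately show ?thesis by simp
qed

lemma computable_takeWhile [computable_intros]:
  assumes "computable (\<lambda>u. b (fst u) (snd u))" "computable l"
  shows "computable (\<lambda>x. takeWhile (b x) (l x))"
proof -
  have b: "computable f \<Longrightarrow> computable g \<Longrightarrow> computable (\<lambda>x. b (f x) (g x))" for f :: "'d::encodable \<Rightarrow> _" and g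
    using computable_compose[OF assms(1), of "\<lambda>x. (f x, g x)"] by (simp add: computable_Pair)
  \<comment> \<open>The list is read from its end; an element that fails discards all that was
    collected behind it.\<close>
  have "computable (\<lambda>x. foldl (\<lambda>a y. if b x y then y # a else []) [] (rev (l x)))"
    by (intro computable_intros assms b)
  moreover have "foldl (\<lambda>a y. if b x y then y # a else []) [] (rev ys) = takeWhile (b x) ys" for x ys
    by (induction ys) auto
  ultimately show ?thesis by simp
qed

section \<open>A stack machine for programs\<close>

text \<open>The constructor and the subprograms are read off the Goedel number, so that their
  computability reduces to arithmetic.\<close>

definition instr :: "recf \<Rightarrow> nat" where
  "instr p = (if goedel p < 5 then goedel p else 5 + (goedel p - 5) mod 4)"

definition arg1 :: "recf \<Rightarrow> recf" where
  "arg1 p = inv goedel (fst (prod_decode ((goedel p - 5) div 4)))"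

definition arg2 :: "recf \<Rightarrow> recf" where
  "arg2 p = inv goedel (snd (prod_decode ((goedel p - 5) div 4)))"

definition body :: "recf \<Rightarrow> recf" where
  "body p = inv goedel ((goedel p - 5) div 4)"

lemma inv_goedel [simp]: "inv goedel (goedel p) = p"
  by (rule inv_f_f[OF inj_goedel])

lemma goedel_inv [simp]: "goedel (inv goedel n) = n"
  by (rule surj_f_inv_f[OF surj_goedel])

lemma instr_simps [simp]:
  "instr Zero = 0" "instr Succ = 1" "instr Fst = 2" "instr Snd = 3" "instr Oracle = 4"
  "instr (Pair p q) = 5" "instr (Comp p q) = 6" "instr (Prec p q) = 7" "instr (Mu p) = 8"
proof -
  have "(Suc (4 * n)) mod 4 = 1" "(Suc (Suc (4 * n))) mod 4 = 2" "(3 + 4 * n) mod 4 = 3" for n :: nat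
    by presburger+
  then show "instr Zero = 0" "instr Succ = 1" "instr Fst = 2" "instr Snd = 3" "instr Oracle = 4"
    "instr (Pair p q) = 5" "instr (Comp p q) = 6" "instr (Prec p q) = 7" "instr (Mu p) = 8"
    by (simp_all add: instr_def)
qed

lemma args_simps [simp]:
  "arg1 (Pair p q) = p" "arg1 (Comp p q) = p" "arg1 (Prec p q) = p"
  "arg2 (Pair p q) = q" "arg2 (Comp p q) = q" "arg2 (Prec p q) = q"
  "body (Mu p) = p"
proof -
  have "(Suc (4 * n)) div 4 = n" "(Suc (Suc (4 * n))) div 4 = n" "(3 + 4 * n) div 4 = n" for n :: nat
    by presburger+
  then show "arg1 (Pair p q) = p" "arg1 (Comp p q) = p" "arg1 (Prec p q) = p"
    "arg2 (Pair p q) = q" "arg2 (Comp p q) = q" "arg2 (Prec p q) = q" "body (Mu p) = p"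
    by (simp_all add: arg1_def arg2_def body_def)
qed

lemma computable_goedel [computable_intros]:
  assumes "computable f"
  shows "computable (\<lambda>x. goedel (f x))"
  by (rule computable_cong_encode[OF assms]) (simp add: encode_recf_def)

lemma computable_inv_goedel [computable_intros]:
  assumes "computable f"
  shows "computable (\<lambda>x. inv goedel (f x))"
  by (rule computable_cong_encode[OF assms]) (simp add: encode_recf_def)

lemma computable_prod_decode [computable_intros]:
  assumes "computable f"
  shows "computable (\<lambda>x. prod_decode (f x))"
  by (rule computable_cong_encode[OF assms]) (simp add: encode_prod_def)

lemma computable_prod_encode [computable_intros]:
  assumes "computable f"
  shows "computable (\<lambda>x. prod_encode (f x))"
  by (rule computable_cong_encode[OF assms]) (simp add: encode_prod_def)

text \<open>
  A configuration consists of the current value and the stack of pending frames.  A frame with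
  tag \<open>0\<close> applies its program to the current value.  Tags \<open>1\<close> and \<open>2\<close> wait for the first and the
  second component of a pair, tag \<open>3\<close> for a value of a primitive recursion and tag \<open>4\<close> for a value
  tested by \<open>Mu\<close>; the number in the frame holds the arguments still needed.
\<close>

type_synonym frame = "nat \<times> recf \<times> nat"
type_synonym config = "nat \<times> frame list"

definition run_step :: "(nat \<Rightarrow> bool) \<Rightarrow> recf \<Rightarrow> nat \<Rightarrow> frame list \<Rightarrow> config" where
  "run_step H p x K =
    (if instr p = 0 then (0, K)
     else if instr p = 1 then (Suc x, K)
     else if instr p = 2 then (fst (prod_decode x), K)
     else if instr p = 3 then (snd (prod_decode x), K)
     else if instr p = 4 then (if H x then 1 else 0, K)
     else if instr p = 5 then (x, (0, arg1 p, 0) # (1, arg2 p, x) # K)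
     else if instr p = 6 then (x, (0, arg2 p, 0) # (0, arg1 p, 0) # K)
     else if instr p = 7 then
       (fst (prod_decode x), (0, arg1 p, 0) #
          (3, arg2 p, prod_encode (fst (prod_decode x), prod_encode (0, snd (prod_decode x)))) # K)
     else (prod_encode (x, 0), (0, body p, 0) # (4, body p, prod_encode (x, 0)) # K))"

definition return_step :: "nat \<Rightarrow> nat \<Rightarrow> recf \<Rightarrow> nat \<Rightarrow> frame list \<Rightarrow> config" where
  "return_step y t p z K =
    (if t = 1 then (z, (0, p, 0) # (2, p, y) # K)
     else if t = 2 then (prod_encode (z, y), K)
     else if t = 3 then
       (case prod_decode z of (a, mn) \<Rightarrow> case prod_decode mn of (m, n) \<Rightarrow>
         if n \<le> m then (y, K)
         else (prod_encode (a, prod_encode (m, y)),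
           (0, p, 0) # (3, p, prod_encode (a, prod_encode (Suc m, n))) # K))
     else
       (case prod_decode z of (a, m) \<Rightarrow>
         if y = 0 then (m, K)
         else (prod_encode (a, Suc m), (0, p, 0) # (4, p, prod_encode (a, Suc m)) # K)))"

definition step :: "(nat \<Rightarrow> bool) \<Rightarrow> config \<Rightarrow> config" where
  "step H c = (case snd c of [] \<Rightarrow> c | f # K \<Rightarrow>
     (case f of (t, p, z) \<Rightarrow> if t = 0 then run_step H p (fst c) K else return_step (fst c) t p z K))"

definition steps :: "(nat \<Rightarrow> bool) \<Rightarrow> nat \<Rightarrow> config \<Rightarrow> config" where
  "steps H t c = rec_nat c (\<lambda>_. step H) t"

abbreviation call :: "recf \<Rightarrow> frame" where
  "call p \<equiv> (0, p, 0)"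

lemma step_simps [simp]:
  "step H (x, []) = (x, [])"
  "step H (x, call Zero # K) = (0, K)"
  "step H (x, call Succ # K) = (Suc x, K)"
  "step H (x, call Fst # K) = (fst (prod_decode x), K)"
  "step H (x, call Snd # K) = (snd (prod_decode x), K)"
  "step H (x, call Oracle # K) = (if H x then 1 else 0, K)"
  "step H (x, call (Pair p q) # K) = (x, call p # (1, q, x) # K)"
  "step H (y, (Suc 0, q, x) # K) = (x, call q # (2, q, y) # K)"
  "step H (z, (2, q, y) # K) = (prod_encode (y, z), K)"
  "step H (x, call (Comp p q) # K) = (x, call q # call p # K)"
  "step H (prod_encode (a, n), call (Prec p q) # K)
     = (a, call p # (3, q, prod_encode (a, prod_encode (0, n))) # K)"
  "step H (r, (3, q, prod_encode (a, prod_encode (m, n))) # K) =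
     (if n \<le> m then (r, K) else (prod_encode (a, prod_encode (m, r)),
           call q # (3, q, prod_encode (a, prod_encode (Suc m, n))) # K))"
  "step H (x, call (Mu p) # K) = (prod_encode (x, 0), call p # (4, p, prod_encode (x, 0)) # K)"
  "step H (r, (4, p, prod_encode (a, m)) # K) =
     (if r = 0 then (m, K)
      else (prod_encode (a, Suc m), call p # (4, p, prod_encode (a, Suc m)) # K))"
  by (simp_all add: step_def run_step_def return_step_def)

lemma steps_0 [simp]: "steps H 0 c = c"
  by (simp add: steps_def)

lemma steps_Suc: "steps H (Suc t) c = steps H t (step H c)"
  unfolding steps_def by (induction t) simp_all

lemma steps_Suc': "steps H (Suc t) c = step H (steps H t c)"
  by (simp add: steps_def)

lemma steps_add: "steps H (s + t) c = steps H t (steps H s c)"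
  by (induction s arbitrary: c) (simp_all add: steps_Suc)

lemma steps_Nil [simp]: "steps H t (x, []) = (x, [])"
  by (induction t) (simp_all add: steps_Suc)

lemma computable_steps [computable_intros]:
  assumes H: "computable (\<lambda>u. H (fst u) (snd u))" and t: "computable t" and c: "computable c"
  shows "computable (\<lambda>x. steps (H x) (t x) (c x))"
proof -
  have H': "computable f \<Longrightarrow> computable g \<Longrightarrow> computable (\<lambda>x. H (f x) (g x))" for f :: "'b::encodable \<Rightarrow> _" and g
    using computable_compose[OF H, of "\<lambda>x. (f x, g x)"] by (simp add: computable_Pair)
  show ?thesis
    unfolding steps_def step_def run_step_def return_step_def instr_def arg1_def arg2_def body_def
    by (intro computable_intros t c H')
qed

section \<open>Agreement of the machine with \<open>eval\<close>\<close>

definition reach :: "(nat \<Rightarrow> bool) \<Rightarrow> config \<Rightarrow> config \<Rightarrow> bool" where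
  "reach H c d \<longleftrightarrow> (\<exists>t. steps H t c = d)"

lemma reach_refl [simp]: "reach H c c"
  unfolding reach_def using steps_0 by blast

lemma reach_step: "reach H (step H c) d \<Longrightarrow> reach H c d"
  unfolding reach_def using steps_Suc by metis

lemma reach_trans: "reach H c d \<Longrightarrow> reach H d e \<Longrightarrow> reach H c e"
  unfolding reach_def using steps_add by metis

text \<open>Here v m is the value after m rounds; the induction runs from the last round
  backwards.\<close>

lemma reach_Prec:
  assumes "\<And>m y K. m < n \<Longrightarrow> v m = Some y \<Longrightarrow> reach H (prod_encode (a, prod_encode (m, y)), call q # K) (the (v (Suc m)), K)"
    and "\<And>m. m \<le> n \<Longrightarrow> v m \<noteq> None" and "m \<le> n"
  shows "reach H (the (v m), (3, q, prod_encode (a, prod_encode (m, n))) # K) (the (v n), K)"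
  using assms(3)
proof (induction rule: inc_induct)
  case base
  show ?case by (rule reach_step) simp
next
  case (step m)
  obtain y where "v m = Some y" using assms(2)[of m] step by auto
  with step show ?case
    using reach_trans[OF assms(1)[of m y] step.IH] by (intro reach_step[of H "(the (v m), _)"]) simp
qed

lemma reach_Mu:
  assumes "\<And>m y K. m \<le> n \<Longrightarrow> reach H (prod_encode (a, m), call p # K) (v m, K)"
    and "\<And>m. m < n \<Longrightarrow> v m \<noteq> 0" "v n = (0::nat)" and "m \<le> n"
  shows "reach H (v m, (4, p, prod_encode (a, m)) # K) (n, K)"
  using assms(4)
proof (induction rule: inc_induct)
  case base
  show ?case by (rule reach_step) (simp add: assms)
next
  case (step m)
  then show ?case
    using reach_trans[OF assms(1)[of "Suc m"] step.IH] assms(2)[of m]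
    by (intro reach_step[of H "(v m, _)"]) simp
qed

text \<open>The frames K are arbitrary so that the induction hypotheses apply to nested calls, which
  return to further frames.\<close>

lemma reach_if_eval:
  "eval A p x = Some y \<Longrightarrow> reach (\<lambda>n. n \<in> A) (x, call p # K) (y, K)"
proof (induction p arbitrary: x y K)
  case (Pair p q)
  then obtain a b where ab: "eval A p x = Some a" "eval A q x = Some b" "y = prod_encode (a, b)"
    by (auto simp: bind_eq_Some_conv)
  show ?case
    apply (rule reach_step, simp)
    apply (rule reach_trans[OF Pair.IH(1)[OF ab(1)]])
    apply (rule reach_step, simp)
    apply (rule reach_trans[OF Pair.IH(2)[OF ab(2)]])
    apply (rule reach_step, simp add: ab)
    done
next
  case (Comp p q)
  then obtain a where a: "eval A q x = Some a" "eval A p a = Some y"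
    by (auto simp: bind_eq_Some_conv)
  show ?case
    apply (rule reach_step, simp)
    apply (rule reach_trans[OF Comp.IH(2)[OF a(1)]])
    apply (rule Comp.IH(1)[OF a(2)])
    done
next
  case (Prec p q)
  obtain a n where x: "x = prod_encode (a, n)"
    by (metis prod_decode_inverse surj_pair)
  define v where "v = rec_nat (eval A p a)
    (\<lambda>m r. Option.bind r (\<lambda>y. eval A q (prod_encode (a, prod_encode (m, y)))))"
  have v: "v 0 = eval A p a"
    "v (Suc m) = Option.bind (v m) (\<lambda>y. eval A q (prod_encode (a, prod_encode (m, y))))" for m
    by (simp_all add: v_def)
  have vn: "v n = Some y" using Prec.prems by (simp add: x v_def)
  have def: "v m \<noteq> None" if "m \<le> n" for m
    using that
  proof (induction rule: inc_induct)
    case (step m) then show ?case by (cases "v m") (auto simp: v)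
  qed (simp add: vn)
  have loop: "reach (\<lambda>n. n \<in> A) (the (v 0), (3, q, prod_encode (a, prod_encode (0, n))) # K) (the (v n), K)"
  proof (rule reach_Prec)
    fix m y K assume "m < n" "v m = Some y"
    then show "reach (\<lambda>n. n \<in> A) (prod_encode (a, prod_encode (m, y)), call q # K) (the (v (Suc m)), K)"
      using def[of "Suc m"] by (intro Prec.IH(2)) (auto simp: v)
  qed (simp_all add: def)
  have "eval A p a = Some (the (v 0))" using def[of 0] v(1) by auto
  from Prec.IH(1)[OF this]
  have start: "reach (\<lambda>n. n \<in> A) (a, call p # (3, q, prod_encode (a, prod_encode (0, n))) # K)
     (the (v 0), (3, q, prod_encode (a, prod_encode (0, n))) # K)" .
  show ?case
    using reach_trans[OF start loop] vn by (intro reach_step[of _ "(x, _)"]) (simp add: x)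
next
  case (Mu p)
  define P where "P n \<longleftrightarrow> eval A p (prod_encode (x, n)) = Some 0" for n
  have ex: "\<exists>n. P n \<and> (\<forall>m<n. eval A p (prod_encode (x, m)) \<noteq> None)" and y: "y = (LEAST n. P n)"
    using Mu.prems by (auto simp: P_def split: if_splits)
  then obtain n where n: "P n" "\<And>m. m < n \<Longrightarrow> eval A p (prod_encode (x, m)) \<noteq> None" by blast
  have Py: "P y" and yn: "y \<le> n" and ny: "\<And>m. m < y \<Longrightarrow> \<not> P m"
    using n(1) unfolding y by (auto intro: LeastI Least_le dest: not_less_Least)
  define v where "v m = the (eval A p (prod_encode (x, m)))" for m
  have ev: "eval A p (prod_encode (x, m)) = Some (v m)" if "m \<le> y" for m
    using n that yn by (cases "m = n") (auto simp: v_def P_def)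
  have loop: "reach (\<lambda>n. n \<in> A) (v 0, (4, p, prod_encode (x, 0)) # K) (y, K)"
    using Py ny ev by (intro reach_Mu Mu.IH) (auto simp: P_def)
  show ?case
    using reach_trans[OF Mu.IH[OF ev[of 0]] loop] by (intro reach_step[of _ "(x, _)"]) simp
qed (rule reach_step, simp)+

text \<open>A halting run splits into the call itself and a strictly shorter run on K from the
  returned value. The strict bound permits induction on the running time for the search of
  \<open>Mu\<close>, whose length is not known beforehand.\<close>

lemma eval_if_halts:
  "steps (\<lambda>n. n \<in> A) t (x, call p # K) = (z, []) \<Longrightarrow>
     \<exists>y s. eval A p x = Some y \<and> s < t \<and> steps (\<lambda>n. n \<in> A) s (y, K) = (z, [])"
proof (induction p arbitrary: t x K)
  case (Pair p q)
  obtain t1 where t1: "t = Suc t1" using Pair.prems by (cases t) auto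
  obtain a t2 where a: "eval A p x = Some a" "t2 < t1"
      "steps (\<lambda>n. n \<in> A) t2 (a, (1, q, x) # K) = (z, [])"
    using Pair.IH(1)[of t1 x "(1, q, x) # K"] Pair.prems by (auto simp: t1 steps_Suc)
  obtain t3 where t3: "t2 = Suc t3" using a by (cases t2) auto
  obtain b t4 where b: "eval A q x = Some b" "t4 < t3"
      "steps (\<lambda>n. n \<in> A) t4 (b, (2, q, a) # K) = (z, [])"
    using Pair.IH(2)[of t3 x "(2, q, a) # K"] a by (auto simp: t3 steps_Suc)
  obtain t5 where t5: "t4 = Suc t5" using b by (cases t4) auto
  have "steps (\<lambda>n. n \<in> A) t5 (prod_encode (a, b), K) = (z, [])" using b by (simp add: t5 steps_Suc)
  moreover have "t5 < t" using t1 t3 t5 a b by simp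
  ultimately show ?case using a(1) b(1) by auto
next
  case (Comp p q)
  obtain t1 where t1: "t = Suc t1" using Comp.prems by (cases t) auto
  obtain a t2 where a: "eval A q x = Some a" "t2 < t1"
      "steps (\<lambda>n. n \<in> A) t2 (a, call p # K) = (z, [])"
    using Comp.IH(2)[of t1 x "call p # K"] Comp.prems by (auto simp: t1 steps_Suc)
  show ?case using Comp.IH(1)[OF a(3)] a t1 by (auto intro: less_trans less_SucI)
next
  case (Prec p q)
  obtain a n where x: "x = prod_encode (a, n)"
    by (metis prod_decode_inverse surj_pair)
  define v where "v = rec_nat (eval A p a)
    (\<lambda>m r. Option.bind r (\<lambda>y. eval A q (prod_encode (a, prod_encode (m, y)))))"
  have v: "v 0 = eval A p a"
    "v (Suc m) = Option.bind (v m) (\<lambda>y. eval A q (prod_encode (a, prod_encode (m, y))))" for m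
    by (simp_all add: v_def)
  have loop: "\<exists>y s. v n = Some y \<and> s < t \<and> steps (\<lambda>n. n \<in> A) s (y, K) = (z, [])"
    if "steps (\<lambda>n. n \<in> A) t (r, (3, q, prod_encode (a, prod_encode (m, n))) # K) = (z, [])"
      "v m = Some r" "m \<le> n" for t r m
    using that(3,1,2)
  proof (induction arbitrary: t r rule: inc_induct)
    case base
    then show ?case by (cases t) (auto simp: steps_Suc)
  next
    case (step m)
    obtain t1 where t1: "t = Suc t1" using step.prems by (cases t) auto
    obtain b t2 where b: "eval A q (prod_encode (a, prod_encode (m, r))) = Some b" "t2 < t1"
        "steps (\<lambda>n. n \<in> A) t2 (b, (3, q, prod_encode (a, prod_encode (Suc m, n))) # K) = (z, [])"
      using Prec.IH(2)[of t1 "prod_encode (a, prod_encode (m, r))"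
          "(3, q, prod_encode (a, prod_encode (Suc m, n))) # K"] step.prems step.hyps
      by (auto simp: t1 steps_Suc)
    show ?case using step.IH[OF b(3)] step.prems b t1 by (auto simp: v intro: less_trans less_SucI)
  qed
  obtain t1 where t1: "t = Suc t1" using Prec.prems by (cases t) auto
  obtain r t2 where r: "eval A p a = Some r" "t2 < t1"
      "steps (\<lambda>n. n \<in> A) t2 (r, (3, q, prod_encode (a, prod_encode (0, n))) # K) = (z, [])"
    using Prec.IH(1)[of t1 a "(3, q, prod_encode (a, prod_encode (0, n))) # K"] Prec.prems
    by (auto simp: t1 steps_Suc x)
  have "eval A (Prec p q) x = v n" by (simp add: x v_def)
  then show ?case using loop[OF r(3)] r v(1) t1 by (auto intro: less_trans less_SucI)
next
  case (Mu p)
  let ?e = "\<lambda>m. eval A p (prod_encode (x, m))"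
  have loop: "\<exists>n s. m \<le> n \<and> ?e n = Some 0 \<and> (\<forall>j. m \<le> j \<and> j < n \<longrightarrow> ?e j \<noteq> None \<and> ?e j \<noteq> Some 0)
       \<and> s < t \<and> steps (\<lambda>n. n \<in> A) s (n, K) = (z, [])"
    if "steps (\<lambda>n. n \<in> A) t (r, (4, p, prod_encode (x, m)) # K) = (z, [])" "?e m = Some r" for t r m
    using that
  proof (induction t arbitrary: r m rule: less_induct)
    case (less t)
    obtain t1 where t1: "t = Suc t1" using less.prems by (cases t) auto
    show ?case
    proof (cases "r = 0")
      case True
      then show ?thesis using less.prems t1 by (intro exI[of _ m] exI[of _ t1]) (auto simp: steps_Suc)
    next
      case False
      then obtain b t2 where b: "?e (Suc m) = Some b" "t2 < t1"
          "steps (\<lambda>n. n \<in> A) t2 (b, (4, p, prod_encode (x, Suc m)) # K) = (z, [])"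
        using Mu.IH[of t1 "prod_encode (x, Suc m)" "(4, p, prod_encode (x, Suc m)) # K"] less.prems
        by (auto simp: t1 steps_Suc)
      then obtain n s where n: "Suc m \<le> n" "?e n = Some 0"
          "\<forall>j. Suc m \<le> j \<and> j < n \<longrightarrow> ?e j \<noteq> None \<and> ?e j \<noteq> Some 0"
          "s < t2" "steps (\<lambda>n. n \<in> A) s (n, K) = (z, [])"
        using less.IH[of t2 b "Suc m"] t1 by auto
      have "?e j \<noteq> None \<and> ?e j \<noteq> Some 0" if "m \<le> j" "j < n" for j
        using that n(3) less.prems(2) False by (cases "j = m") auto
      then show ?thesis using n b t1 by (intro exI[of _ n] exI[of _ s]) auto
    qed
  qed
  obtain t1 where t1: "t = Suc t1" using Mu.prems by (cases t) auto
  obtain r t2 where r: "?e 0 = Some r" "t2 < t1"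
      "steps (\<lambda>n. n \<in> A) t2 (r, (4, p, prod_encode (x, 0)) # K) = (z, [])"
    using Mu.IH[of t1 "prod_encode (x, 0)" "(4, p, prod_encode (x, 0)) # K"] Mu.prems
    by (auto simp: t1 steps_Suc)
  from loop[OF r(3,1)] obtain n s where n: "?e n = Some 0" "\<And>j. j < n \<Longrightarrow> ?e j \<noteq> None \<and> ?e j \<noteq> Some 0"
       "s < t2" "steps (\<lambda>n. n \<in> A) s (n, K) = (z, [])" by auto
  have "(LEAST n. ?e n = Some 0) = n"
    using n by (intro Least_equality) (auto simp: not_less[symmetric])
  then have "eval A (Mu p) x = Some n" using n by auto
  moreover have "s < t" using n r t1 by simp
  ultimately show ?case using n by blast
qed (case_tac t; auto simp: steps_Suc)+

section \<open>Step-bounded computations\<close>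

definition result :: "(nat \<Rightarrow> bool) \<Rightarrow> nat \<Rightarrow> recf \<Rightarrow> nat \<Rightarrow> nat option" where
  "result H t p x = (case steps H t (x, [call p]) of (y, K) \<Rightarrow> case K of [] \<Rightarrow> Some y | f # K' \<Rightarrow> None)"

lemma computable_result [computable_intros]:
  assumes "computable (\<lambda>u. H (fst u) (snd u))" "computable t" "computable p" "computable x"
  shows "computable (\<lambda>z. result (H z) (t z) (p z) (x z))"
  unfolding result_def by (intro computable_intros assms)

lemma result_eq_Some_iff: "result H t p x = Some y \<longleftrightarrow> steps H t (x, [call p]) = (y, [])"
  by (auto simp: result_def split: prod.splits list.splits)

lemma result_mono: "result H t p x = Some y \<Longrightarrow> t \<le> s \<Longrightarrow> result H s p x = Some y"
  using steps_add[of H t "s - t" "(x, [call p])"] by (simp add: result_eq_Some_iff)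

lemma eval_eq_Some_iff:
  "eval A p x = Some y \<longleftrightarrow> (\<exists>t. result (\<lambda>n. n \<in> A) t p x = Some y)"
proof
  assume "eval A p x = Some y"
  from reach_if_eval[OF this, of "[]"] show "\<exists>t. result (\<lambda>n. n \<in> A) t p x = Some y"
    by (auto simp: reach_def result_eq_Some_iff)
next
  assume "\<exists>t. result (\<lambda>n. n \<in> A) t p x = Some y"
  then obtain t where "steps (\<lambda>n. n \<in> A) t (x, [call p]) = (y, [])" by (auto simp: result_eq_Some_iff)
  from eval_if_halts[OF this] show "eval A p x = Some y" by auto
qed

lemma Phi_eq_Some_iff:
  "Phi A i x = Some y \<longleftrightarrow> (\<exists>t. result (\<lambda>n. n \<in> A) t (inv goedel i) x = Some y)"
  unfolding Phi_def by (rule eval_eq_Some_iff)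

section \<open>Computable approximations of functions computable in the halting set\<close>

definition halts_within :: "nat \<Rightarrow> nat \<Rightarrow> nat \<Rightarrow> bool" where
  "halts_within s i x \<longleftrightarrow> result (\<lambda>_. False) s (inv goedel i) x \<noteq> None"

lemma computable_halts_within [computable_intros]:
  assumes "computable s" "computable i" "computable x"
  shows "computable (\<lambda>z. halts_within (s z) (i z) (x z))"
proof -
  have "computable (\<lambda>z. case result (\<lambda>_. False) (s z) (inv goedel (i z)) (x z) of None \<Rightarrow> False | Some y \<Rightarrow> True)"
    by (intro computable_intros assms)
  then show ?thesis
    by (rule computable_cong_encode) (simp add: halts_within_def split: option.split)
qed

lemma halts_within_mono: "halts_within s i x \<Longrightarrow> s \<le> t \<Longrightarrow> halts_within t i x"
  by (auto simp: halts_within_def dest: result_mono)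

lemma W_iff_halts_within: "x \<in> W i \<longleftrightarrow> (\<exists>s. halts_within s i x)"
  using Phi_eq_Some_iff[of "{}" i x] by (auto simp: W_def halts_within_def dom_def)

definition approx :: "nat \<Rightarrow> nat \<Rightarrow> nat \<Rightarrow> nat \<Rightarrow> nat option" where
  "approx s t i x = result (\<lambda>n. halts_within s n n) t (inv goedel i) x"

lemma computable_approx [computable_intros]:
  assumes "computable s" "computable t" "computable i" "computable x"
  shows "computable (\<lambda>z. approx (s z) (t z) (i z) (x z))"
  unfolding approx_def
  by (intro computable_intros assms computable_compose[OF assms(1)])

lemma eventually_halts_within_iff:
  "\<forall>\<^sub>F s in sequentially. halts_within s n n \<longleftrightarrow> n \<in> halting_set"
proof (cases "n \<in> halting_set")
  case True
  then obtain s where "halts_within s n n" by (auto simp: halting_set_def W_iff_halts_within)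
  then have "\<forall>t\<ge>s. halts_within t n n" using halts_within_mono by blast
  with True show ?thesis by (auto simp: eventually_sequentially)
next
  case False
  then show ?thesis by (auto simp: halting_set_def W_iff_halts_within)
qed

text \<open>Each step asks at most one oracle question, so pointwise convergence of the oracles
  suffices for a fixed number of steps.\<close>

lemma eventually_steps_eq:
  assumes "\<And>n. \<forall>\<^sub>F s in sequentially. H s n = A n"
  shows "\<forall>\<^sub>F s in sequentially. steps (H s) t c = steps A t c"
proof (induction t)
  case (Suc t)
  obtain x K where c: "steps A t c = (x, K)" by fastforce
  have "step (H s) (x, K) = step A (x, K)" if "H s x = A x" for s
    using that by (auto simp: step_def run_step_def split: list.split)
  moreover have "\<forall>\<^sub>F s in sequentially. steps (H s) t c = steps A t c \<and> H s x = A x"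
    using Suc assms[of x] by (rule eventually_conj)
  ultimately show ?case
    by (auto elim!: eventually_mono simp: steps_Suc' c)
qed simp

text \<open>With t fixed, the limit in s is right also where the run has not halted; this could fail
  if t grew along with s.\<close>

lemma eventually_approx_eq:
  "\<forall>\<^sub>F s in sequentially. approx s t i x = result (\<lambda>n. n \<in> halting_set) t (inv goedel i) x"
proof -
  have "\<forall>\<^sub>F s in sequentially. steps (\<lambda>n. halts_within s n n) t (x, [call (inv goedel i)])
      = steps (\<lambda>n. n \<in> halting_set) t (x, [call (inv goedel i)])"
    using eventually_halts_within_iff by (intro eventually_steps_eq) simp
  then show ?thesis by (auto elim!: eventually_mono simp: approx_def result_def)
qed

section \<open>The recursion theorem\<close>

text \<open>Needed for the recursion theorem, where a program has its own source written into it as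
  a constant. The 1 in the recursion is the Goedel number of \<open>Succ\<close>.\<close>

lemma computable_goedel_const_recf [computable_intros]:
  assumes "computable f"
  shows "computable (\<lambda>x. goedel (const_recf (f x)))"
proof -
  have "computable (\<lambda>x. rec_nat 0 (\<lambda>m r. 6 + 4 * prod_encode (1, r)) (f x))"
    by (intro computable_intros assms)
  moreover have "rec_nat 0 (\<lambda>m r. 6 + 4 * prod_encode (1, r)) n = goedel (const_recf n)" for n
    by (induction n) simp_all
  ultimately show ?thesis by simp
qed

text \<open>Kleene's argument: \<open>diag u\<close> is an index of the function that runs program u
  on the pair of u and x. If p computes g at \<open>diag u\<close> and x from this pair, then taking
  u to be the number of p itself makes \<open>diag u\<close> the fixed point.\<close>

theorem recursion_theorem:
  fixes g :: "nat \<times> nat \<Rightarrow> nat"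
  assumes "computable g"
  obtains e where "\<And>A x. Phi A e x = Some (g (e, x))"
proof -
  define diag where
    "diag u = goedel (Comp (inv goedel u) (Pair (const_recf u) (Pair Fst Snd)))" for u
  have "computable (\<lambda>z :: nat \<times> nat. (diag (fst z), snd z))"
    unfolding diag_def goedel.simps goedel_inv by (intro computable_intros)
  from computable_compose[OF assms this]
  obtain p where p: "\<And>A z. eval A p (encode z) = Some (encode (g (diag (fst z), snd z)))"
    unfolding computable_def by blast
  have "Phi A (diag (goedel p)) x = Some (g (diag (goedel p), x))" for A x
    using p[of A "(goedel p, x)"] by (simp add: Phi_def diag_def del: goedel.simps)
  then show thesis by (rule that)
qed

section \<open>Paths and blocks\<close>

primrec other :: "color \<Rightarrow> color" where
  "other BLUE = RED"
| "other RED = BLUE"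

lemma other_neq [simp]: "other \<kappa> \<noteq> \<kappa>" "\<kappa> \<noteq> other \<kappa>"
  by (cases \<kappa>; simp)+

lemma mono_path_defined_below: "mono_path c \<kappa> P \<Longrightarrow> P n = Some y \<Longrightarrow> m \<le> n \<Longrightarrow> P m \<noteq> None"
  unfolding mono_path_def by (cases "m = n") (auto simp: dom_def)

lemma mono_path_inj: "mono_path c \<kappa> P \<Longrightarrow> P m = Some x \<Longrightarrow> P n = Some x \<Longrightarrow> m = n"
  unfolding mono_path_def by (metis domI inj_onD)

text \<open>
  The block \<open>{u..<2 * u + 2}\<close> is too large for the path of color \<open>\<kappa>\<close>: after each of its vertices
  but the last one on the path, such a path must use a vertex below \<open>u\<close>.
\<close>

lemma path_misses_block:
  assumes P: "mono_path c \<kappa> P"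
    and block: "\<And>x y. u \<le> x \<Longrightarrow> x < 2 * u + 2 \<Longrightarrow> x < y \<Longrightarrow> c {x, y} = other \<kappa>"
  shows "\<not> {u..<2 * u + 2} \<subseteq> ran P"
proof
  assume sub: "{u..<2 * u + 2} \<subseteq> ran P"
  then have "\<forall>x\<in>{u..<2 * u + 2}. \<exists>n. P n = Some x" by (auto simp: ran_def)
  then obtain pos where pos: "\<And>x. x \<in> {u..<2 * u + 2} \<Longrightarrow> P (pos x) = Some x" by metis
  \<comment> \<open>The position of the last block vertex on the path; every other block vertex
    therefore has a successor.\<close>
  define l where "l = Max (pos ` {u..<2 * u + 2})"
  have "l \<in> pos ` {u..<2 * u + 2}" unfolding l_def by (intro Max_in) auto
  then obtain z where z: "z \<in> {u..<2 * u + 2}" "pos z = l" by auto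
  have le: "pos x \<le> l" if "x \<in> {u..<2 * u + 2}" for x
    unfolding l_def using that by (intro Max_ge) auto
  define succ where "succ x = the (P (Suc (pos x)))" for x
  have step: "succ x < u \<and> P (Suc (pos x)) = Some (succ x)" if x: "x \<in> {u..<2 * u + 2} - {z}" for x
  proof -
    have "pos x \<noteq> pos z" using pos[of x] pos[of z] x z by auto
    then have "Suc (pos x) \<le> l" using le[of x] x z by auto
    then have s: "P (Suc (pos x)) = Some (succ x)"
      using mono_path_defined_below[OF P, of l z] pos[OF z(1)] z(2) by (auto simp: succ_def)
    then have col: "c {x, succ x} = \<kappa>" using P pos[of x] x unfolding mono_path_def by blast
    have ne: "succ x \<noteq> x"
    proof
      assume "succ x = x"
      then have "Suc (pos x) = pos x" using mono_path_inj[OF P] s pos[of x] x by auto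
      then show False by simp
    qed
    have "succ x < u"
    proof (rule ccontr)
      assume "\<not> succ x < u"
      \<comment> \<open>Whichever of the two is smaller lies in the block.\<close>
      then have "c {min x (succ x), max x (succ x)} = other \<kappa>"
        using x ne by (intro block) (auto simp: min_def max_def)
      moreover have "{min x (succ x), max x (succ x)} = {x, succ x}" by (auto simp: min_def max_def)
      ultimately show False using col by simp
    qed
    with s show ?thesis by simp
  qed
  have "inj_on succ ({u..<2 * u + 2} - {z})"
  proof (rule inj_onI)
    fix x y assume xy: "x \<in> {u..<2 * u + 2} - {z}" "y \<in> {u..<2 * u + 2} - {z}" "succ x = succ y"
    then have "Suc (pos x) = Suc (pos y)"
      using step[of x] step[of y] mono_path_inj[OF P] by metis
    then have "pos x = pos y" by simp
    then show "x = y" using pos xy by (metis DiffD1 option.inject)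
  qed
  moreover have "succ ` ({u..<2 * u + 2} - {z}) \<subseteq> {..<u}" using step by blast
  \<comment> \<open>Without z the block has u + 1 vertices, one too many for an injection below
    u.\<close>
  ultimately have "card ({u..<2 * u + 2} - {z}) \<le> card {..<u}" by (intro card_inj_on_le) auto
  then show False using z by simp
qed

text \<open>A block vertex missed by P lies on Q. Consider the first vertex of Q that is at least u:
  its predecessor, if any, is below u, and the color of the edge between them keeps the predecessor
  out of \<open>{b..<u}\<close>.\<close>

lemma path_leaves_initial_segment:
  assumes P: "mono_path c \<kappa> P" and Q: "mono_path c (other \<kappa>) Q"
    and cover: "ran P \<union> ran Q = UNIV"
    and low: "\<And>x y. b \<le> x \<Longrightarrow> x < u \<Longrightarrow> u \<le> y \<Longrightarrow> c {x, y} = \<kappa>"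
    and block: "\<And>x y. u \<le> x \<Longrightarrow> x < 2 * u + 2 \<Longrightarrow> x < y \<Longrightarrow> c {x, y} = other \<kappa>"
  obtains n y where "Q n = Some y" "u \<le> y" "n = 0 \<or> (\<exists>v. Q (n - 1) = Some v \<and> v < b)"
proof -
  have "\<not> {u..<2 * u + 2} \<subseteq> ran P" by (rule path_misses_block[OF P block])
  then obtain y where "y \<in> {u..<2 * u + 2}" "y \<notin> ran P" by blast
  then have "y \<in> ran Q" "u \<le> y" using cover by auto
  then have ex: "\<exists>n. \<exists>y. Q n = Some y \<and> u \<le> y" by (auto simp: ran_def)
  define n where "n = (LEAST n. \<exists>y. Q n = Some y \<and> u \<le> y)"
  obtain y where y: "Q n = Some y" "u \<le> y"
    using LeastI_ex[OF ex] unfolding n_def by blast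
  have "\<exists>v. Q (n - 1) = Some v \<and> v < b" if "n \<noteq> 0"
  proof -
    have "n - 1 < n" using that by simp
    then obtain v where v: "Q (n - 1) = Some v"
      using mono_path_defined_below[OF Q y(1), of "n - 1"] by auto
    have "\<not> (\<exists>y. Q (n - 1) = Some y \<and> u \<le> y)"
      using \<open>n - 1 < n\<close> unfolding n_def by (rule not_less_Least)
    then have vu: "v < u" using v by auto
    have "Q (Suc (n - 1)) = Some y" using y that by simp
    then have "c {v, y} = other \<kappa>" using Q v unfolding mono_path_def by blast
    then have "v < b" using low[of v y] vu y by (metis not_le other_neq(2))
    with v show ?thesis by blast
  qed
  with y show thesis by (intro that) auto
qed

text \<open>An undefined value bounds the domain of a path, and two finite paths cannot cover the
  natural numbers.\<close>

lemma one_path_total: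
  assumes "mono_path c \<kappa> P" "mono_path c \<mu> Q" "ran P \<union> ran Q = UNIV"
  shows "(\<forall>n. P n \<noteq> None) \<or> (\<forall>n. Q n \<noteq> None)"
proof (rule ccontr)
  assume "\<not> ?thesis"
  then obtain m n where "P m = None" "Q n = None" by blast
  then have "dom P \<subseteq> {..<m}" "dom Q \<subseteq> {..<n}"
    using mono_path_defined_below[OF assms(1), of _ _ m] mono_path_defined_below[OF assms(2), of _ _ n]
    by (meson domD lessThan_iff not_le subsetI)+
  then have "finite (dom P)" "finite (dom Q)"
    by (auto intro: finite_subset)
  then have "finite (ran P)" "finite (ran Q)"
    by (auto intro: finite_ran)
  then show False using assms(3) infinite_UNIV_nat by (metis finite_UnI)
qed

section \<open>The construction\<close>

text \<open>
  An entry \<open>(k, b, u)\<close> attacks the candidate \<open>target k\<close>: with \<open>\<kappa> = BLUE\<close> if \<open>blue_turn k\<close> and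
  \<open>\<kappa> = RED\<close> otherwise, new vertices are joined to \<open>{b..<u}\<close> in color \<open>\<kappa>\<close> and to \<open>{u..<2 * u + 2}\<close>
  in the other color, until the candidate shows that its path of the other color leaves \<open>{..<u}\<close>
  from a vertex below \<open>b\<close> or starts outside.  The vertices below \<open>b\<close> belong to earlier entries.
\<close>

type_synonym entry = "nat \<times> nat \<times> nat"

definition target :: "nat \<Rightarrow> nat" where
  "target k = fst (prod_decode k)"

definition blue_turn :: "nat \<Rightarrow> bool" where
  "blue_turn k = even (snd (prod_decode k))"

text \<open>The fold forgets all but the last entry: a new interval starts where the block of that
  entry ends.\<close>

definition base :: "entry list \<Rightarrow> nat" where
  "base st = foldl (\<lambda>_ e. 2 * snd (snd e) + 2) 0 st"

definition join_blue :: "entry list \<Rightarrow> nat \<Rightarrow> bool" where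
  "join_blue st x = foldl (\<lambda>a e. case e of (k, b, u) \<Rightarrow>
     if b \<le> x \<and> x < 2 * u + 2 then (if x < u then blue_turn k else \<not> blue_turn k) else a) True st"

text \<open>
  Answered entries are removed together with all later ones, and the search for a replacement goes
  on behind the key of the answered entry.  So each key that is eligible at a fixed level is tried
  there unless the level settles before.
\<close>

definition next_state ::
  "(nat \<Rightarrow> bool) \<Rightarrow> (entry \<Rightarrow> bool) \<Rightarrow> nat \<Rightarrow> nat \<times> entry list \<Rightarrow> nat \<times> entry list" where
  "next_state V a s z = (case z of (k, st) \<Rightarrow>
     case find a st of
       Some e \<Rightarrow> (Suc (fst e), takeWhile (\<lambda>e. \<not> a e) st)
     | None \<Rightarrow>
         if V (target k) \<and> \<not> (\<exists>e\<in>set st. target (fst e) = target k)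
         then (0, st @ [(k, base st, max (Suc s) (base st))])
         else (Suc k, st))"

definition state :: "(nat \<Rightarrow> nat \<Rightarrow> bool) \<Rightarrow> (nat \<Rightarrow> entry \<Rightarrow> bool) \<Rightarrow> nat \<Rightarrow> nat \<times> entry list" where
  "state V a s = rec_nat (0, []) (\<lambda>s. next_state (V s) (a s) s) s"

text \<open>The intervals \<open>{b..<2 * u + 2}\<close> of successive entries are adjacent and
  start at 0, so each vertex below \<open>base st\<close> belongs to exactly one entry.\<close>

definition well_formed :: "entry list \<Rightarrow> bool" where
  "well_formed st \<longleftrightarrow> (\<forall>xs k b u ys. st = xs @ (k, b, u) # ys \<longrightarrow> b = base xs \<and> b \<le> u)"

lemma well_formed_Nil: "well_formed []"
  by (simp add: well_formed_def)

lemma well_formed_middle: "well_formed (xs @ (k, b, u) # ys) \<Longrightarrow> b = base xs \<and> b \<le> u"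
  unfolding well_formed_def by blast

lemma well_formed_append1:
  assumes "well_formed (xs @ ys)"
  shows "well_formed xs"
  unfolding well_formed_def
proof (intro allI impI)
  fix zs k b u zs'
  assume "xs = zs @ (k, b, u) # zs'"
  with assms show "b = base zs \<and> b \<le> u" using well_formed_middle[of zs k b u "zs' @ ys"] by simp
qed

lemma well_formed_snoc:
  "well_formed (st @ [(k, b, u)]) \<longleftrightarrow> well_formed st \<and> b = base st \<and> b \<le> u"
proof
  assume R: "well_formed st \<and> b = base st \<and> b \<le> u"
  show "well_formed (st @ [(k, b, u)])"
    unfolding well_formed_def
  proof (intro allI impI)
    fix xs k' b' u' ys
    assume "st @ [(k, b, u)] = xs @ (k', b', u') # ys"
    then show "b' = base xs \<and> b' \<le> u'"
      using R well_formed_middle[of xs k' b' u'] by (cases ys rule: rev_cases) auto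
  qed
next
  assume "well_formed (st @ [(k, b, u)])"
  then show "well_formed st \<and> b = base st \<and> b \<le> u"
    using well_formed_append1 well_formed_middle[of st k b u "[]"] by blast
qed

lemma base_snoc [simp]: "base (st @ [(k, b, u)]) = 2 * u + 2"
  by (simp add: base_def)

lemma entry_below_base:
  "well_formed st \<Longrightarrow> (k, b, u) \<in> set st \<Longrightarrow> b \<le> u \<and> 2 * u + 2 \<le> base st"
proof (induction st rule: rev_induct)
  case (snoc e st)
  obtain k' b' u' where "e = (k', b', u')" by (cases e)
  with snoc show ?case by (fastforce simp: well_formed_snoc)
qed simp

text \<open>Later entries begin at \<open>2 * u + 2\<close> or beyond and cannot override the color
  at x.\<close>

lemma join_blue_eq:
  assumes "well_formed st" "(k, b, u) \<in> set st" "b \<le> x" "x < 2 * u + 2"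
  shows "join_blue st x = (if x < u then blue_turn k else \<not> blue_turn k)"
  using assms(1,2)
proof (induction st rule: rev_induct)
  case (snoc e st)
  obtain k' b' u' where e: "e = (k', b', u')" by (cases e)
  show ?case
  proof (cases "(k, b, u) = e")
    case True
    then show ?thesis using assms(3,4) by (auto simp: join_blue_def)
  next
    case False
    then have "x < b'" using snoc.prems entry_below_base[of st k b u] assms(4)
      by (auto simp: e well_formed_snoc)
    then have "join_blue (st @ [e]) x = join_blue st x" by (simp add: join_blue_def e)
    then show ?thesis using snoc False by (auto simp: e well_formed_snoc)
  qed
qed simp

text \<open>The succession of attacks is analysed for any predicate a of answers; its connection
  with paths enters only afterwards.\<close>

locale construction =
  fixes V :: "nat \<Rightarrow> nat \<Rightarrow> bool" and a :: "nat \<Rightarrow> entry \<Rightarrow> bool" and D :: "nat set"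
  assumes finite_D: "finite D"
    and V_in_D: "V s d \<Longrightarrow> d \<in> D"
    and eventually_V: "\<forall>\<^sub>F s in sequentially. \<forall>d\<in>D. V s d"
begin

abbreviation key :: "nat \<Rightarrow> nat" where "key s \<equiv> fst (state V a s)"
abbreviation stack :: "nat \<Rightarrow> entry list" where "stack s \<equiv> snd (state V a s)"

lemma state_0: "state V a 0 = (0, [])"
  by (simp add: state_def)

lemma state_Suc: "state V a (Suc s) = next_state (V s) (a s) s (state V a s)"
  by (simp add: state_def)

lemma stage_cases:
  obtains
    (pop) e i where "i < length (stack s)" "stack s ! i = e" "a s e" "stack (Suc s) = take i (stack s)"
      "key (Suc s) = Suc (fst e)" "\<And>e. e \<in> set (stack (Suc s)) \<Longrightarrow> \<not> a s e"
  | (push) "\<And>e. e \<in> set (stack s) \<Longrightarrow> \<not> a s e" "V s (target (key s))"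
      "target (key s) \<notin> (\<lambda>e. target (fst e)) ` set (stack s)" "key (Suc s) = 0"
      "stack (Suc s) = stack s @ [(key s, base (stack s), max (Suc s) (base (stack s)))]"
  | (skip) "\<And>e. e \<in> set (stack s) \<Longrightarrow> \<not> a s e" "key (Suc s) = Suc (key s)"
      "\<not> V s (target (key s)) \<or> target (key s) \<in> (\<lambda>e. target (fst e)) ` set (stack s)"
      "stack (Suc s) = stack s"
proof (cases "find (a s) (stack s)")
  case None
  then have no: "\<And>e. e \<in> set (stack s) \<Longrightarrow> \<not> a s e" by (auto simp: find_None_iff)
  show thesis
  proof (cases "V s (target (key s)) \<and> \<not> (\<exists>e\<in>set (stack s). target (fst e) = target (key s))")
    case True
    then have "state V a (Suc s) =
        (0, stack s @ [(key s, base (stack s), max (Suc s) (base (stack s)))])"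
      using None by (simp add: state_Suc next_state_def split_beta)
    with True no show thesis by (intro push) auto
  next
    case False
    then have "state V a (Suc s) = (Suc (key s), stack s)"
      using None by (auto simp: state_Suc next_state_def split_beta)
    moreover have "\<not> V s (target (key s)) \<or> target (key s) \<in> (\<lambda>e. target (fst e)) ` set (stack s)"
      using False by force
    ultimately show thesis using no by (intro skip) auto
  qed
next
  case (Some e)
  then obtain i where i: "i < length (stack s)" "a s e" "e = stack s ! i" "\<And>j. j < i \<Longrightarrow> \<not> a s (stack s ! j)"
    by (auto simp: find_Some_iff)
  have "takeWhile (\<lambda>e. \<not> a s e) (stack s) = take i (stack s)"
    using i by (intro takeWhile_eq_take_P_nth) auto
  then have "stack (Suc s) = take i (stack s)" "key (Suc s) = Suc (fst e)"
    using Some by (simp_all add: state_Suc next_state_def split_beta)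
  moreover have "\<not> a s e'" if "e' \<in> set (take i (stack s))" for e'
    using that i by (auto simp: in_set_conv_nth)
  ultimately show thesis using i by (intro pop[of i e]) auto
qed

text \<open>A new entry gets a u larger than the current stage. Hence, as long as it lasts, it has
  been present at every stage from u on, and its colors apply to all new vertices from u on. As keys
  do not exceed the stage, also k < u, so large keys force large u.\<close>

lemma invariant:
  "key s \<le> s \<and> well_formed (stack s) \<and> distinct (map (\<lambda>e. target (fst e)) (stack s))
     \<and> (\<forall>(k, b, u)\<in>set (stack s). k \<le> s \<and> k < u \<and> target k \<in> D
         \<and> (\<forall>r. u \<le> r \<longrightarrow> r \<le> s \<longrightarrow> (k, b, u) \<in> set (stack r)))"
proof (induction s)
  case 0
  show ?case by (simp add: state_0 well_formed_Nil)
next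
  case (Suc s)
  show ?case
  proof (cases rule: stage_cases[of s])
    case (pop e i)
    have "well_formed (stack (Suc s))"
      using Suc pop(4) well_formed_append1[of "take i (stack s)" "drop i (stack s)"] by simp
    moreover have "distinct (map (\<lambda>e. target (fst e)) (stack (Suc s)))"
      using Suc pop(4) by (simp add: take_map[symmetric])
    moreover have "e \<in> set (stack s)" using pop(1,2) by auto
    then have "fst e \<le> s" using Suc by (cases e) auto
    moreover have "set (stack (Suc s)) \<subseteq> set (stack s)" using pop(4) by (simp add: set_take_subset)
    ultimately show ?thesis using Suc pop(5) by (fastforce simp: le_Suc_eq)
  next
    case push
    then show ?thesis using Suc V_in_D by (auto simp: well_formed_snoc le_Suc_eq split_beta)
  next
    case skip
    then show ?thesis using Suc by (auto simp: le_Suc_eq split_beta)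
  qed
qed

section \<open>Levels of the stack that become constant\<close>

definition settled :: "nat \<Rightarrow> entry list \<Rightarrow> nat \<Rightarrow> bool" where
  "settled l pre S \<longleftrightarrow> length pre = l \<and> (\<forall>s\<ge>S. take l (stack s) = pre)"

text \<open>The targets in a stack are distinct elements of D. This yields a largest level up to
  which the stack becomes constant.\<close>

lemma settled_length: "settled l pre S \<Longrightarrow> l \<le> card D"
proof -
  assume s: "settled l pre S"
  then have "l = length (take l (stack S))" by (auto simp: settled_def)
  also have "\<dots> \<le> length (stack S)" by simp
  also have "\<dots> = card ((\<lambda>e. target (fst e)) ` set (stack S))"
    using invariant[of S] distinct_card[of "map (\<lambda>e. target (fst e)) (stack S)"] by simp
  also have "\<dots> \<le> card D"
    using invariant[of S] by (intro card_mono finite_D) auto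
  finally show ?thesis .
qed

text \<open>An answered entry is removed at once, either as the first answered one or together with
  an earlier one.\<close>

lemma settled_not_answered:
  assumes "settled l pre S" "s \<ge> S" "e \<in> set pre"
  shows "e \<in> set (stack s)" "\<not> a s e"
proof -
  have *: "take l (stack r) = pre" if "r \<ge> S" for r using assms that by (auto simp: settled_def)
  have sub: "set pre \<subseteq> set (stack r)" if "r \<ge> S" for r
    using *[OF that] set_take_subset by metis
  show "e \<in> set (stack s)" using sub assms by blast
  have "e \<in> set (stack (Suc s))" using sub[of "Suc s"] assms by auto
  then show "\<not> a s e"
    using \<open>e \<in> set (stack s)\<close> by (cases rule: stage_cases[of s]) auto
qed

text \<open>The key on trial at level l. Unlike \<open>key\<close>, it is not reset when an attack
  starts at a later level.\<close>

definition level_key :: "nat \<Rightarrow> nat \<Rightarrow> nat" where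
  "level_key l s = (if l < length (stack s) then fst (stack s ! l) else key s)"

lemma level_step:
  assumes "settled l pre S" "s \<ge> S"
  shows "level_key l (Suc s) = level_key l s \<and>
      l < length (stack (Suc s)) \<and> (l < length (stack s) \<longrightarrow> stack (Suc s) ! l = stack s ! l)
    \<or> level_key l (Suc s) = Suc (level_key l s) \<and>
      (if l < length (stack s) then a s (stack s ! l)
       else \<not> V s (target (level_key l s)) \<or> target (level_key l s) \<in> (\<lambda>e. target (fst e)) ` set pre)"
proof -
  have t: "take l (stack s) = pre" "take l (stack (Suc s)) = pre" "length pre = l"
    using assms by (auto simp: settled_def)
  have "length (take l (stack s)) = l" "length (take l (stack (Suc s))) = l" by (simp_all only: t)
  then have len: "l \<le> length (stack s)" "l \<le> length (stack (Suc s))" by simp_all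
  show ?thesis
  proof (cases rule: stage_cases[of s])
    case (pop e i)
    \<comment> \<open>The first l entries survive, so the removed entry is at position l or
      later.\<close>
    have "l \<le> i" using len pop(4) by simp
    then show ?thesis using pop by (cases "i = l") (auto simp: level_key_def)
  next
    case push
    then show ?thesis using len by (auto simp: level_key_def nth_append)
  next
    case skip
    then show ?thesis using len t by (auto simp: level_key_def)
  qed
qed

text \<open>The key at level l moves up in steps of one. If it comes to rest, one entry occupies the
  level for good; otherwise it reaches and leaves every number from its value at S on.\<close>

lemma settled_or_unbounded:
  assumes st: "settled l pre S"
  shows "(\<exists>pre S. settled (Suc l) pre S) \<or> (\<forall>k\<ge>level_key l S. \<exists>s\<ge>S. level_key l s = k \<and> level_key l (Suc s) = Suc k)"
proof (cases "\<exists>T\<ge>S. \<forall>s\<ge>T. level_key l s = level_key l T")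
  case True
  then obtain T where T: "T \<ge> S" "\<And>s. s \<ge> T \<Longrightarrow> level_key l s = level_key l T" by blast
  have "level_key l (Suc s) = level_key l s" if "s \<ge> T" for s
    using T(2)[OF that] T(2)[OF le_SucI[OF that]] by (simp only:)
  then have stay: "l < length (stack (Suc s)) \<and> (l < length (stack s) \<longrightarrow> stack (Suc s) ! l = stack s ! l)"
    if "s \<ge> T" for s
    using level_step[OF st le_trans[OF T(1) that]] that by auto
  have stable: "l < length (stack s) \<and> stack s ! l = stack (Suc T) ! l" if "s \<ge> Suc T" for s
    using that
  proof (induction s rule: dec_induct)
    case base
    show ?case using stay[of T] by simp
  next
    case (step s)
    then show ?case using stay[of s] by simp
  qed
  have "take (Suc l) (stack s) = pre @ [stack (Suc T) ! l]" if s: "s \<ge> Suc T" for s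
  proof -
    have "take l (stack s) = pre" using st T(1) s unfolding settled_def by (meson Suc_leD le_trans)
    with stable[OF s] show ?thesis using take_Suc_conv_app_nth[of l "stack s"] by metis
  qed
  moreover have "length pre = l" using st by (simp add: settled_def)
  ultimately have "settled (Suc l) (pre @ [stack (Suc T) ! l]) (Suc T)"
    by (simp add: settled_def)
  then show ?thesis by blast
next
  case False
  have leave: "\<exists>s\<ge>S. level_key l s = k \<and> level_key l (Suc s) = Suc k" if T: "T \<ge> S" "level_key l T = k" for k T
  proof (rule ccontr)
    assume no: "\<not> ?thesis"
    have "level_key l r = k" if "r \<ge> T" for r
      using that
    proof (induction r rule: dec_induct)
      case (step r)
      then have "S \<le> r" using T(1) by simp
      with step.IH no level_step[OF st \<open>S \<le> r\<close>] show ?case by blast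
    qed (rule T)
    then show False using False T by auto
  qed
  have "\<exists>s\<ge>S. level_key l s = k" if "k \<ge> level_key l S" for k
    using that
  proof (induction k rule: dec_induct)
    case (step k)
    then show ?case using leave by (meson le_SucI)
  qed blast
  then show ?thesis using leave by blast
qed

text \<open>Take the largest l for which the first l entries become constant. If d is among their
  targets, that attack lasts forever. Otherwise every large key with target d is tried at level l
  and, being eligible there, can be left only through an answer; all these attacks share
  \<open>base pre\<close>.\<close>

theorem attack:
  assumes d: "d \<in> D"
  obtains (stuck) S k b u where "target k = d" "b \<le> u"
      "\<And>s. u \<le> s \<Longrightarrow> (k, b, u) \<in> set (stack s)" "\<And>s. S \<le> s \<Longrightarrow> \<not> a s (k, b, u)"
  | (unbounded) b where
      "\<And>N p. \<exists>s k u. N < u \<and> target k = d \<and> blue_turn k = p \<and> a s (k, b, u)"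
proof -
  have "settled 0 [] 0" by (simp add: settled_def)
  then have ex: "\<exists>l. \<exists>pre S. settled l pre S" by blast
  have bound: "l \<le> card D" if "\<exists>pre S. settled l pre S" for l
    using that settled_length by blast
  define l where "l = (GREATEST l. \<exists>pre S. settled l pre S)"
  have "\<exists>pre S. settled l pre S"
    unfolding l_def using bound by (intro GreatestI_ex_nat[OF ex]) blast
  then obtain pre S0 where S0: "settled l pre S0" by blast
  obtain S1 where S1: "\<And>s d. s \<ge> S1 \<Longrightarrow> d \<in> D \<Longrightarrow> V s d"
    using eventually_V by (auto simp: eventually_sequentially)
  define S where "S = max S0 S1"
  have S: "settled l pre S" using S0 by (auto simp: settled_def S_def)
  have "\<not> (\<exists>pre S. settled (Suc l) pre S)"
    using bound Greatest_le_nat[of "\<lambda>l. \<exists>pre S. settled l pre S" "Suc l" "card D"]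
    unfolding l_def[symmetric] by auto
  with settled_or_unbounded[OF S] have
    unb: "\<And>k. k \<ge> level_key l S \<Longrightarrow> \<exists>s\<ge>S. level_key l s = k \<and> level_key l (Suc s) = Suc k"
    by blast
  show thesis
  proof (cases "d \<in> (\<lambda>e. target (fst e)) ` set pre")
    case True
    then obtain k b u where e: "(k, b, u) \<in> set pre" "target k = d" by force
    have e': "(k, b, u) \<in> set (stack s)" "\<not> a s (k, b, u)" if "s \<ge> S" for s
      using settled_not_answered[OF S that e(1)] by auto
    have "(k, b, u) \<in> set (stack r)" if "u \<le> r" for r
      using invariant[of "max r S"] e'(1)[of "max r S"] that by fastforce
    moreover have "b \<le> u" using entry_below_base[of "stack S" k b u] invariant[of S] e'(1)[of S] by simp
    ultimately show thesis using e(2) e'(2) by (intro stuck[of k b u S])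
  next
    case False
    show thesis
    proof (rule unbounded[of "base pre"])
      fix N p
      \<comment> \<open>The parity of the second component encodes p, and its size makes k at least
        N and \<open>level_key l S\<close>.\<close>
      define k where "k = prod_encode (d, 2 * (level_key l S + N) + (if p then 0 else 1))"
      have k: "target k = d" "blue_turn k = p"
        by (simp_all add: k_def target_def blue_turn_def)
      have "2 * (level_key l S + N) \<le> k"
        using le_prod_encode_2[of "2 * (level_key l S + N) + (if p then 0 else 1)" d] by (simp add: k_def)
      then have "level_key l S \<le> k" "N \<le> k" by auto
      with unb obtain s where s: "s \<ge> S" "level_key l s = k" "level_key l (Suc s) = Suc k" by blast
      have "V s (target k)" using S1 d s(1) k by (simp add: S_def)
      then have l: "l < length (stack s)" and ans: "a s (stack s ! l)"
        using level_step[OF S s(1)] s k False by (auto split: if_splits)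
      obtain b u where e: "stack s ! l = (k, b, u)"
        using s(2) l by (cases "stack s ! l") (auto simp: level_key_def)
      have "stack s = pre @ (k, b, u) # drop (Suc l) (stack s)"
        using S s(1) l e id_take_nth_drop[OF l] by (simp add: settled_def)
      then have "b = base pre" using invariant[of s] well_formed_middle[of pre k b u] by metis
      moreover have "k < u" using invariant[of s] e l by (metis (no_types, lifting) case_prodD nth_mem)
      ultimately show "\<exists>s k u. N < u \<and> target k = d \<and> blue_turn k = p \<and> a s (k, base pre, u)"
        using ans e k \<open>N \<le> k\<close> by (intro exI[of _ s] exI[of _ k] exI[of _ u]) auto
    qed
  qed
qed

end

section \<open>Answers of candidates\<close>

text \<open>A candidate codes the indices of its blue and its red path, in this order. In a blue
  turn the red path is the one that must leave \<open>{..<u}\<close>.\<close>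

definition stay_index :: "nat \<Rightarrow> nat" where
  "stay_index k = (if blue_turn k then fst (prod_decode (target k)) else snd (prod_decode (target k)))"

definition leave_index :: "nat \<Rightarrow> nat" where
  "leave_index k = (if blue_turn k then snd (prod_decode (target k)) else fst (prod_decode (target k)))"

text \<open>
  The time bound \<open>t\<close> of the approximation is independent of the stage \<open>s\<close> of the oracle: for fixed
  \<open>t\<close> and large \<open>s\<close> no undefined value appears defined, while \<open>u \<le> t\<close> ensures that values that are
  defined appear once \<open>u\<close> is large.  The last conjunct says that the index \<open>n - 1\<close> of the vertex
  \<open>v\<close> is the first one at which either path seems to meet \<open>v\<close>, and bounds \<open>n\<close> in the long run.
\<close>

definition answered :: "nat \<Rightarrow> entry \<Rightarrow> bool" where
  "answered s e = (case e of (k, b, u) \<Rightarrow>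
     \<exists>t\<le>s. \<exists>n\<le>s. u \<le> t \<and>
       (case approx s t (leave_index k) n of None \<Rightarrow> False | Some y \<Rightarrow> u \<le> y \<and>
          (n = 0 \<or> (case approx s t (leave_index k) (n - 1) of None \<Rightarrow> False | Some v \<Rightarrow> v < b \<and>
             (\<forall>m<n - 1. approx s t (leave_index k) m \<noteq> Some v \<and> approx s t (stay_index k) m \<noteq> Some v)))))"

section \<open>Computability of the construction\<close>

lemma computable_eq_Some [computable_intros]:
  fixes v :: "'a::encodable \<Rightarrow> nat"
  assumes "computable z" "computable v"
  shows "computable (\<lambda>x. z x = Some (v x))"
proof -
  have "computable (\<lambda>x. case z x of None \<Rightarrow> False | Some y \<Rightarrow> y = v x)"
    by (intro computable_intros assms computable_compose[OF assms(2)])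
  then show ?thesis by (rule computable_cong_encode) (simp split: option.split)
qed

lemma computable_target [computable_intros]: "computable f \<Longrightarrow> computable (\<lambda>x. target (f x))"
  unfolding target_def by (intro computable_intros)

lemma computable_blue_turn [computable_intros]: "computable f \<Longrightarrow> computable (\<lambda>x. blue_turn (f x))"
  unfolding blue_turn_def by (intro computable_intros)

lemma computable_stay_index [computable_intros]: "computable f \<Longrightarrow> computable (\<lambda>x. stay_index (f x))"
  unfolding stay_index_def by (intro computable_intros)

lemma computable_leave_index [computable_intros]: "computable f \<Longrightarrow> computable (\<lambda>x. leave_index (f x))"
  unfolding leave_index_def by (intro computable_intros)

lemma computable_answered [computable_intros]:
  assumes "computable s" "computable e"
  shows "computable (\<lambda>x. answered (s x) (e x))"
  unfolding answered_def
  by (intro computable_intros assms assms[THEN computable_compose])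

lemma computable_state [computable_intros]:
  assumes V: "computable (\<lambda>u. V (fst u) (fst (snd u)) (snd (snd u)))" and s: "computable s"
  shows "computable (\<lambda>x. state (V x) answered (s x))"
proof -
  have V': "computable f \<Longrightarrow> computable g \<Longrightarrow> computable h \<Longrightarrow> computable (\<lambda>x. V (f x) (g x) (h x))"
    for f :: "'b::encodable \<Rightarrow> _" and g h
    using computable_compose[OF V, of "\<lambda>x. (f x, g x, h x)"] by (simp add: computable_Pair)
  show ?thesis
    unfolding state_def next_state_def base_def
    by (intro computable_intros s V')
qed

lemma computable_join_blue [computable_intros]:
  assumes "computable st" "computable x"
  shows "computable (\<lambda>z. join_blue (st z) (x z))"
  unfolding join_blue_def
  by (intro computable_intros assms computable_compose[OF assms(2)])

section \<open>When answers occur\<close>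

lemma approx_mono: "approx s t i x = Some y \<Longrightarrow> t \<le> t' \<Longrightarrow> approx s t' i x = Some y"
  unfolding approx_def by (rule result_mono)

text \<open>One running time T yields the value; once the oracle is correct for it, longer runs at
  the same stage keep it.\<close>

lemma eventually_approx:
  assumes "Phi halting_set i x = Some y"
  shows "\<forall>\<^sub>F N in sequentially. \<forall>t\<ge>N. \<forall>s\<ge>t. approx s t i x = Some y"
proof -
  obtain T where T: "result (\<lambda>n. n \<in> halting_set) T (inv goedel i) x = Some y"
    using assms by (auto simp: Phi_eq_Some_iff)
  obtain S where S: "\<And>s. s \<ge> S \<Longrightarrow> approx s T i x = Some y"
    using eventually_approx_eq[of T i x] T by (auto simp: eventually_sequentially)
  have "approx s t i x = Some y" if "max S T \<le> t" "t \<le> s" for s t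
    by (rule approx_mono[OF S]) (use that in simp_all)
  then show ?thesis unfolding eventually_sequentially by (metis le_trans)
qed

text \<open>First t is chosen large enough for the values at n and n - 1, then s large enough that
  all results up to n within time t are true ones. No earlier occurrence of the predecessor can then
  appear, as Q is injective and disjoint from P.\<close>

lemma eventually_answered:
  assumes Q: "Phi halting_set (leave_index k) = Q" and P: "Phi halting_set (stay_index k) = P"
    and inj: "mono_path c \<kappa> Q" and disj: "ran P \<inter> ran Q = {}"
    and y: "Q n = Some y" "u \<le> y" and v: "n = 0 \<or> (\<exists>v. Q (n - 1) = Some v \<and> v < b)"
  shows "\<forall>\<^sub>F s in sequentially. answered s (k, b, u)"
proof -
  let ?r = "\<lambda>t i. result (\<lambda>n. n \<in> halting_set) t (inv goedel i)"
  have halt: "\<exists>T. \<forall>t\<ge>T. ?r t (leave_index k) m = Some w" if "Q m = Some w" for m w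
  proof -
    obtain T where "?r T (leave_index k) m = Some w"
      using \<open>Q m = Some w\<close> by (auto simp: Q[symmetric] Phi_eq_Some_iff)
    then show ?thesis using result_mono by blast
  qed
  have sound: "Phi halting_set i m = Some w" if "?r t i m = Some w" for t i m w
    using that Phi_eq_Some_iff by blast
  obtain t where t: "u \<le> t" "?r t (leave_index k) n = Some y"
    "n \<noteq> 0 \<Longrightarrow> ?r t (leave_index k) (n - 1) = Q (n - 1)"
  proof -
    obtain T where T: "\<forall>t\<ge>T. ?r t (leave_index k) n = Some y" using halt[OF y(1)] by blast
    show thesis
    proof (cases "n = 0")
      case True
      with T show thesis by (intro that[of "max u T"]) auto
    next
      case False
      then obtain w where w: "Q (n - 1) = Some w" using v by blast
      obtain T' where "\<forall>t\<ge>T'. ?r t (leave_index k) (n - 1) = Some w" using halt[OF w] by blast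
      with T w show thesis by (intro that[of "max u (max T T')"]) auto
    qed
  qed
  have "\<forall>\<^sub>F s in sequentially. \<forall>m\<in>{..n}. approx s t (leave_index k) m = ?r t (leave_index k) m
      \<and> approx s t (stay_index k) m = ?r t (stay_index k) m"
    by (intro eventually_ball_finite ballI eventually_conj eventually_approx_eq finite_atMost)
  moreover have "\<forall>\<^sub>F s in sequentially. max t n \<le> s" by (rule eventually_ge_at_top)
  ultimately show ?thesis
  proof eventually_elim
    case (elim s)
    then have ap: "approx s t (leave_index k) m = ?r t (leave_index k) m"
      "approx s t (stay_index k) m = ?r t (stay_index k) m" if "m \<le> n" for m
      using that by auto
    have first: "approx s t (leave_index k) m \<noteq> Some w \<and> approx s t (stay_index k) m \<noteq> Some w"
      if w: "Q (n - 1) = Some w" and m: "m < n - 1" for m w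
    proof
      show "approx s t (leave_index k) m \<noteq> Some w"
        using ap(1)[of m] sound[of t "leave_index k" m w] mono_path_inj[OF inj w, of m] m Q by auto
      show "approx s t (stay_index k) m \<noteq> Some w"
        using ap(2)[of m] sound[of t "stay_index k" m w] m P w disj by (auto simp: ran_def)
    qed
    have "case approx s t (leave_index k) n of None \<Rightarrow> False | Some y \<Rightarrow> u \<le> y \<and>
          (n = 0 \<or> (case approx s t (leave_index k) (n - 1) of None \<Rightarrow> False | Some v \<Rightarrow> v < b \<and>
             (\<forall>m<n - 1. approx s t (leave_index k) m \<noteq> Some v \<and> approx s t (stay_index k) m \<noteq> Some v)))"
    proof (cases "n = 0")
      case True
      then show ?thesis using t ap(1)[of n] y by simp
    next
      case False
      then obtain w where w: "Q (n - 1) = Some w" "w < b" using v by blast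
      have "approx s t (leave_index k) n = Some y" "approx s t (leave_index k) (n - 1) = Some w"
        using t(2) t(3)[OF False] w ap(1)[of n] ap(1)[of "n - 1"] by simp_all
      then show ?thesis using y(2) w(2) first[OF w(1)] by simp
    qed
    moreover have "t \<le> s" "n \<le> s" using elim by auto
    ultimately show ?case
      unfolding answered_def prod.case using t(1) by blast
  qed
qed

text \<open>Every vertex below b occurs before position M on one of the paths, and from N on the
  approximations give all defined values up to M. If u > N, an answer with n <= M would show the
  true value of the total path at n, which is at most N; for n > M, the vertex at n - 1 would have
  appeared earlier.\<close>

lemma finitely_often_answered:
  assumes Q: "\<And>n. Phi halting_set i n \<noteq> None"
    and cover: "ran (Phi halting_set j) \<union> ran (Phi halting_set i) = UNIV"
  obtains N where
    "\<And>s k u. leave_index k = i \<Longrightarrow> stay_index k = j \<Longrightarrow> N < u \<Longrightarrow> \<not> answered s (k, b, u)"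
proof -
  let ?\<Phi> = "Phi halting_set"
  have "\<forall>\<^sub>F M in sequentially. \<exists>m<M. ?\<Phi> j m = Some v \<or> ?\<Phi> i m = Some v" for v
  proof -
    have "v \<in> ran (?\<Phi> j) \<union> ran (?\<Phi> i)" using cover by simp
    then obtain m where "?\<Phi> j m = Some v \<or> ?\<Phi> i m = Some v" by (auto simp: ran_def)
    then have "\<forall>M\<ge>Suc m. \<exists>m<M. ?\<Phi> j m = Some v \<or> ?\<Phi> i m = Some v" by (auto simp: Suc_le_eq)
    then show ?thesis unfolding eventually_sequentially by blast
  qed
  then have "\<forall>\<^sub>F M in sequentially. \<forall>v\<in>{..<b}. \<exists>m<M. ?\<Phi> j m = Some v \<or> ?\<Phi> i m = Some v"
    by (intro eventually_ball_finite) auto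
  from eventually_happens'[OF sequentially_bot this]
  obtain M where "\<forall>v\<in>{..<b}. \<exists>m<M. ?\<Phi> j m = Some v \<or> ?\<Phi> i m = Some v"
    by (rule exE)
  then have M: "\<exists>m<M. ?\<Phi> j m = Some v \<or> ?\<Phi> i m = Some v" if "v < b" for v
    using that by simp
  have conv: "\<forall>\<^sub>F N in sequentially. \<forall>t\<ge>N. \<forall>s\<ge>t. \<forall>w. ?\<Phi> l m = Some w \<longrightarrow> approx s t l m = Some w" for l m
  proof (cases "?\<Phi> l m")
    case (Some w)
    from eventually_approx[OF this] Some show ?thesis by (auto elim: eventually_mono)
  qed simp
  have "\<forall>\<^sub>F N in sequentially.
      (\<forall>t\<ge>N. \<forall>s\<ge>t. \<forall>w. ?\<Phi> i m = Some w \<longrightarrow> approx s t i m = Some w) \<and>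
      (\<forall>t\<ge>N. \<forall>s\<ge>t. \<forall>w. ?\<Phi> j m = Some w \<longrightarrow> approx s t j m = Some w) \<and> the (?\<Phi> i m) \<le> N" for m
    using conv[of i m] conv[of j m] eventually_ge_at_top[of "the (?\<Phi> i m)"]
    by eventually_elim blast
  then have "\<forall>\<^sub>F N in sequentially. \<forall>m\<in>{..M}.
      (\<forall>t\<ge>N. \<forall>s\<ge>t. \<forall>w. ?\<Phi> i m = Some w \<longrightarrow> approx s t i m = Some w) \<and>
      (\<forall>t\<ge>N. \<forall>s\<ge>t. \<forall>w. ?\<Phi> j m = Some w \<longrightarrow> approx s t j m = Some w) \<and> the (?\<Phi> i m) \<le> N"
    by (intro eventually_ball_finite finite_atMost ballI)
  from eventually_happens'[OF sequentially_bot this] obtain N where *: "\<forall>m\<in>{..M}.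
      (\<forall>t\<ge>N. \<forall>s\<ge>t. \<forall>w. ?\<Phi> i m = Some w \<longrightarrow> approx s t i m = Some w) \<and>
      (\<forall>t\<ge>N. \<forall>s\<ge>t. \<forall>w. ?\<Phi> j m = Some w \<longrightarrow> approx s t j m = Some w) \<and> the (?\<Phi> i m) \<le> N"
    by (rule exE)
  have N: "\<And>m t s w. m \<le> M \<Longrightarrow> N \<le> t \<Longrightarrow> t \<le> s \<Longrightarrow> ?\<Phi> i m = Some w \<Longrightarrow> approx s t i m = Some w"
    "\<And>m t s w. m \<le> M \<Longrightarrow> N \<le> t \<Longrightarrow> t \<le> s \<Longrightarrow> ?\<Phi> j m = Some w \<Longrightarrow> approx s t j m = Some w"
    "\<And>m. m \<le> M \<Longrightarrow> the (?\<Phi> i m) \<le> N"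
    using * by simp_all
  have "\<not> answered s (k, b, u)" if k: "leave_index k = i" "stay_index k = j" "N < u" for s k u
  proof
    assume "answered s (k, b, u)"
    then obtain t n y where t: "t \<le> s" "u \<le> t" and y: "approx s t i n = Some y" "u \<le> y"
      and v: "n \<noteq> 0 \<Longrightarrow> \<exists>v. approx s t i (n - 1) = Some v \<and> v < b \<and>
        (\<forall>m<n - 1. approx s t i m \<noteq> Some v \<and> approx s t j m \<noteq> Some v)"
      unfolding answered_def by (fastforce simp: k split: option.splits)
    have Nt: "N \<le> t" using t k by simp
    show False
    proof (cases "n \<le> M")
      case True
      obtain w where w: "?\<Phi> i n = Some w" using Q[of n] by auto
      then have "w = y" using N(1)[OF True Nt t(1) w] y by simp
      then show False using N(3)[OF True] w y k by simp
    next
      case False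
      then obtain v where "v < b" and v: "\<And>m. m < n - 1 \<Longrightarrow> approx s t i m \<noteq> Some v"
        "\<And>m. m < n - 1 \<Longrightarrow> approx s t j m \<noteq> Some v" using v by auto
      from M[OF \<open>v < b\<close>] obtain m where "m < M" "?\<Phi> j m = Some v \<or> ?\<Phi> i m = Some v" by blast
      then show False using N(1,2)[of m t s v] Nt t v[of m] False by auto
    qed
  qed
  then show thesis by (rule that)
qed

section \<open>Non-uniformity of path decompositions\<close>

text \<open>With p a program for f, this is the part of \<open>W (f e)\<close> found by stage s; it
  is empty until \<open>f e\<close> has converged.\<close>

definition enumerated :: "recf \<Rightarrow> nat \<Rightarrow> nat \<Rightarrow> nat \<Rightarrow> bool" where
  "enumerated p e s d = (case result (\<lambda>_. False) s p e of None \<Rightarrow> False | Some i \<Rightarrow> halts_within s i d)"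

text \<open>The larger vertex y serves as the stage of the construction, so a new vertex is joined
  to all earlier ones according to a single stack.\<close>

definition join :: "recf \<Rightarrow> nat \<Rightarrow> nat \<Rightarrow> nat \<Rightarrow> bool" where
  "join p e x y = join_blue (snd (state (enumerated p e) answered y)) x"

lemma computable_join:
  "computable (\<lambda>(e, z). case prod_decode z of (x, y) \<Rightarrow> if join p e x y then 0 else (1 :: nat))"
  unfolding join_def enumerated_def by (intro computable_intros)

lemma construction_enumerated:
  assumes i: "eval {} p e = Some i" and fin: "finite (W i)"
  shows "construction (enumerated p e) (W i)"
proof
  show "finite (W i)" by (rule fin)
  fix s d
  assume "enumerated p e s d"
  then obtain i' where i': "result (\<lambda>_. False) s p e = Some i'" and d: "halts_within s i' d"
    by (auto simp: enumerated_def split: option.splits)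
  then have "eval {} p e = Some i'" using eval_eq_Some_iff[of "{}" p e i'] by auto
  then show "d \<in> W i" using i d by (auto simp: W_iff_halts_within)
next
  obtain s0 where s0: "result (\<lambda>_. False) s0 p e = Some i"
    using i eval_eq_Some_iff[of "{}" p e i] by auto
  have "\<forall>\<^sub>F s in sequentially. enumerated p e s d" if d: "d \<in> W i" for d
  proof -
    obtain s1 where "halts_within s1 i d" using d unfolding W_iff_halts_within by blast
    then have "enumerated p e s d" if "max s0 s1 \<le> s" for s
      using that result_mono[OF s0, of s] halts_within_mono[of s1 i d s] by (simp add: enumerated_def)
    then show ?thesis unfolding eventually_sequentially by blast
  qed
  then show "\<forall>\<^sub>F s in sequentially. \<forall>d\<in>W i. enumerated p e s d"
    by (intro eventually_ball_finite fin) blast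
qed

theorem theorem8:
  shows "\<not> (\<exists>f :: nat \<rightharpoonup> nat. partial_computable f \<and>
    (\<forall>e c. coloring_index e c \<longrightarrow>
      (\<exists>i. f e = Some i \<and> finite (W i) \<and>
        (\<exists>d\<in>W i. \<exists>Pb Pr. delta2_path_decomposition c Pb Pr \<and> decomposition_index d Pb Pr))))"
proof
  assume "\<exists>f :: nat \<rightharpoonup> nat. partial_computable f \<and>
    (\<forall>e c. coloring_index e c \<longrightarrow>
      (\<exists>i. f e = Some i \<and> finite (W i) \<and>
        (\<exists>d\<in>W i. \<exists>Pb Pr. delta2_path_decomposition c Pb Pr \<and> decomposition_index d Pb Pr)))"
  then obtain f :: "nat \<rightharpoonup> nat" where "partial_computable f" and
    f: "\<And>e c. coloring_index e c \<Longrightarrow> \<exists>i. f e = Some i \<and> finite (W i) \<and>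
      (\<exists>d\<in>W i. \<exists>Pb Pr. delta2_path_decomposition c Pb Pr \<and> decomposition_index d Pb Pr)"
    by blast
  then obtain p where p: "eval {} p = f"
    by (auto simp: partial_computable_in_def Phi_def)
  obtain e where e: "\<And>A z. Phi A e z
      = Some (case prod_decode z of (x, y) \<Rightarrow> if join p e x y then 0 else 1)"
    using recursion_theorem[OF computable_join[of p]] by (auto simp: split_beta)
  define c where "c X = (if join p e (Min X) (Max X) then BLUE else RED)" for X
  have c: "c {x, y} = (if join p e x y then BLUE else RED)" if "x < y" for x y
    using that by (simp add: c_def min_def max_def)
  \<comment> \<open>The coloring is total even if \<open>f e\<close> diverges or
    \<open>W (f e)\<close> is infinite; convergence and finiteness follow only from the hypothesis
    applied to this index.\<close>
  have "coloring_index e c" by (auto simp: coloring_index_def e c)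
  from f[OF this] obtain i d Pb Pr where i: "f e = Some i" "finite (W i)" and d: "d \<in> W i"
    and dec: "delta2_path_decomposition c Pb Pr" "decomposition_index d Pb Pr" by blast
  define ib ir where "ib = fst (prod_decode d)" and "ir = snd (prod_decode d)"
  have idx: "Phi halting_set ib = Pb" "Phi halting_set ir = Pr"
    using dec(2) by (auto simp: decomposition_index_def ib_def ir_def)
  have paths: "mono_path c BLUE Pb" "mono_path c RED Pr" "ran Pb \<union> ran Pr = UNIV" "ran Pb \<inter> ran Pr = {}"
    using dec(1) by (auto simp: delta2_path_decomposition_def)
  have index: "leave_index k = (if blue_turn k then ir else ib)" "stay_index k = (if blue_turn k then ib else ir)"
    if "target k = d" for k
    using that by (simp_all add: leave_index_def stay_index_def ib_def ir_def)
  interpret construction "enumerated p e" answered "W i"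
    using i p by (intro construction_enumerated) auto
  show False
  proof (rule attack[OF d], goal_cases stuck unbounded)
    case (stuck S k b u)
    define \<kappa> where "\<kappa> = (if blue_turn k then BLUE else RED)"
    define P where "P = (if blue_turn k then Pb else Pr)"
    define Q where "Q = (if blue_turn k then Pr else Pb)"
    have PQ: "mono_path c \<kappa> P" "mono_path c (other \<kappa>) Q" "ran P \<union> ran Q = UNIV" "ran P \<inter> ran Q = {}"
      using paths by (auto simp: \<kappa>_def P_def Q_def)
    \<comment> \<open>The attack is in the stack at every stage y from u on, so its colors hold
      without exception.\<close>
    have col: "c {x, y} = (if x < u then \<kappa> else other \<kappa>)"
      if "b \<le> x" "x < 2 * u + 2" "x < y" "u \<le> y" for x y
      using that stuck(3)[of y] invariant[of y] join_blue_eq[of "stack y" k b u x]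
      by (auto simp: c join_def \<kappa>_def)
    obtain n y where ny: "Q n = Some y" "u \<le> y" "n = 0 \<or> (\<exists>v. Q (n - 1) = Some v \<and> v < b)"
    proof (rule path_leaves_initial_segment[OF PQ(1-3)])
      show "c {x, y} = \<kappa>" if "b \<le> x" "x < u" "u \<le> y" for x y using col[of x y] that by simp
      show "c {x, y} = other \<kappa>" if "u \<le> x" "x < 2 * u + 2" "x < y" for x y
        using col[of x y] that stuck(2) by simp
    qed
    have "\<forall>\<^sub>F s in sequentially. answered s (k, b, u)"
      using index[OF stuck(1)] idx
      by (intro eventually_answered[OF _ _ PQ(2,4) ny]) (simp_all add: P_def Q_def)
    then show False using stuck(4) by (auto simp: eventually_sequentially) (metis nat_le_linear)
  next
    case (unbounded b)
    have total: "(\<forall>n. Pb n \<noteq> None) \<or> (\<forall>n. Pr n \<noteq> None)"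
      by (rule one_path_total[OF paths(1-3)])
    \<comment> \<open>The turn is chosen so that the path that must leave is an infinite
      one.\<close>
    define r where "r = (\<forall>n. Pr n \<noteq> None)"
    have "Phi halting_set (if r then ir else ib) n \<noteq> None" for n
    proof (cases r)
      case True
      then have "Pr n \<noteq> None" unfolding r_def by (rule spec)
      with True show ?thesis by (simp add: idx)
    next
      case False
      then have "Pb n \<noteq> None" using total unfolding r_def by blast
      with False show ?thesis by (simp add: idx)
    qed
    moreover have "ran (Phi halting_set (if r then ib else ir))
        \<union> ran (Phi halting_set (if r then ir else ib)) = UNIV"
      using paths(3) by (simp add: idx Un_commute)
    ultimately obtain N where N: "\<And>s k u. leave_index k = (if r then ir else ib) \<Longrightarrow>
        stay_index k = (if r then ib else ir) \<Longrightarrow> N < u \<Longrightarrow> \<not> answered s (k, b, u)"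
      by (rule finitely_often_answered[where b = b]) blast
    from unbounded[of N r] obtain s k u where
      "N < u" "target k = d" "blue_turn k = r" "answered s (k, b, u)" by blast
    with N[of k u s] index show False by simp
  qed
qed

end
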